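(* There is an absolute constant $C$ such that the following holds. For all integers $N>30$, all intervals $I\subset\mathbb Z$ of length $N$, and all sets $F,G\subset I$, with $f=\mathbf 1_F$ and $g=\mathbf 1_G$, $$N^{-1}\langle A_N f,g\rangle\le C\,\langle f\rangle_I\,\langle g\rangle_I\,\bigl(\operatorname{Log}(\langle f\rangle_I\langle g\rangle_I)\bigr)^{t},$$ where $t=2$ unconditionally, and where one can take $t=1$ if the Generalized Riemann Hypothesis is assumed.
   Context: An interval is a finite set of consecutive integers; its length is its cardinality $|I|$. The von Mangoldt function is $\Lambda(n)=\log p$ if $n=p^a$ with $p$ prime and $a\ge1$, and $\Lambda(n)=0$ otherwise. For $f:\mathbb Z\to\mathbb C$ of finite support, $$A_Nf(x)=\frac1N\sum_{1\le n\le N}f(x-n)\Lambda(n).$$ $\langle u,v\rangle=\sum_{x\in\mathbb Z}u(x)\overline{v(x)}$. $\langle f\rangle_I=|I|^{-1}\sum_{x\in I}|f(x)|$. $\operatorname{Log}x=1+|\log x|$ for $x>0$; an expression $y(\operatorname{Log}y)^t$ is read as $0$ when $y=0$. The Generalized Riemann Hypothesis is the assertion that, for every Dirichlet character, all zeros of the associated Dirichlet $L$-function in the strip $0<\operatorname{Re}(s)<1$ lie on the line $\operatorname{Re}(s)=\frac12$. *)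

theory Defs
  imports "HOL-Analysis.Analysis" "HOL-Number_Theory.Prime_Powers"
begin

definition prime_avg :: "nat \<Rightarrow> (int \<Rightarrow> complex) \<Rightarrow> int \<Rightarrow> complex" where
  "prime_avg N f x = 1 / of_nat N * (\<Sum>n=1..N. f (x - int n) * mangoldt n)"

text \<open>On the finitely supported functions considered here the infinite sum is a finite sum.
  Inequalities between complex values below use the library order on \<^typ>\<open>complex\<close>, which
  compares real parts of numbers with equal imaginary parts; \<open>\<le>\<close> with a real right-hand side
  thus includes that the left-hand side is real.\<close>

definition pairing :: "(int \<Rightarrow> complex) \<Rightarrow> (int \<Rightarrow> complex) \<Rightarrow> complex" where
  "pairing u v = (\<Sum>\<^sub>\<infinity>x\<in>UNIV. u x * cnj (v x))"

definition int_interval :: "int set \<Rightarrow> bool" where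
  "int_interval I \<longleftrightarrow> (\<exists>a b. I = {a..b})"

definition avg_on :: "int set \<Rightarrow> (int \<Rightarrow> complex) \<Rightarrow> real" where
  "avg_on I f = (\<Sum>x\<in>I. cmod (f x)) / real (card I)"

text \<open>Meant for positive arguments. Since \<^term>\<open>Log 0\<close> is a finite real number,
  \<^term>\<open>y * Log y ^ t\<close> takes the conventional value \<^term>\<open>0::real\<close> at \<^term>\<open>y = (0::real)\<close>.\<close>

definition Log :: "real \<Rightarrow> real" where
  "Log x = 1 + \<bar>ln x\<bar>"

definition dirichlet_character :: "nat \<Rightarrow> (nat \<Rightarrow> complex) \<Rightarrow> bool" where
  "dirichlet_character q \<psi> \<longleftrightarrow> q > 0 \<and>
     (\<forall>m n. \<psi> (m * n) = \<psi> m * \<psi> n) \<and>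
     (\<forall>n. \<psi> (n + q) = \<psi> n) \<and>
     (\<forall>n. \<psi> n = 0 \<longleftrightarrow> \<not> coprime n q)"

text \<open>
  The Dirichlet \<open>L\<close>-function on the half plane \<open>Re s > 0\<close>, obtained by analytic continuation
  of the Dirichlet series from \<open>Re s > 1\<close>. The continuation exists for every Dirichlet character
  and is unique, because the half plane punctured at \<open>1\<close> is connected. The point \<open>1\<close> is left out
  because of the pole for principal characters; the value there is unspecified.
\<close>

definition dirichlet_L :: "(nat \<Rightarrow> complex) \<Rightarrow> complex \<Rightarrow> complex" where
  "dirichlet_L \<psi> = (SOME L. L holomorphic_on ({s. Re s > 0} - {1}) \<and>
     (\<forall>s. Re s > 1 \<longrightarrow> L s = (\<Sum>n. \<psi> (Suc n) / of_nat (Suc n) powr s)))"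

definition generalized_riemann_hypothesis :: bool where
  "generalized_riemann_hypothesis \<longleftrightarrow>
     (\<forall>q \<psi>. dirichlet_character q \<psi> \<longrightarrow>
        (\<forall>s. 0 < Re s \<and> Re s < 1 \<and> dirichlet_L \<psi> s = 0 \<longrightarrow> Re s = 1 / 2))"

end

theory Submission
  imports Defs "HOL-Computational_Algebra.Squarefree"
begin

text \<open>
  Write \<open>a\<close> and \<open>b\<close> for the cardinalities of \<open>F\<close> and \<open>G\<close>, and \<open>y = a b / N\<^sup>2\<close>. The left-hand
  side is \<open>N\<^sup>-\<^sup>2\<close> times the sum of \<open>\<Lambda>(x - z)\<close> over \<open>x \<in> G\<close> and \<open>z \<in> F\<close> with \<open>1 \<le> x - z \<le> N\<close>. This
  sum is at most a constant times \<open>a b Log y\<close>; the exponent two then follows from \<open>Log y \<ge> 1\<close>. All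
  terms are nonnegative and only an upper bound is wanted, so the primes may be replaced by a sieve
  majorant, whose Fourier coefficients are explicit.

  If \<open>y \<le> N\<^sup>-\<^sup>1\<^sup>/\<^sup>2\<close>, then \<open>\<Lambda> \<le> log N \<le> 2 Log y\<close> and nothing remains to be shown. Otherwise, let \<open>R\<close> be
  about \<open>N\<^sup>1\<^sup>/\<^sup>8\<close> and \<open>Q\<close> about \<open>20 / y\<close>. Selberg's sieve is applied to the sequence that counts
  the representations \<open>n = x - z\<close>, with the primes \<open>p \<in> (Q, R]\<close> only. Leaving out the primes up to
  \<open>Q\<close> costs a factor \<open>log Q\<close>, which the bound \<open>a b Log y\<close> allows. The gain is that the
  majorant has mean value proportional to \<open>log Q / log N\<close>, and that all its other frequencies are
  fractions with denominator greater than \<open>Q\<close>.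

  The majorant is the square of a combination of normalised Ramanujan sums. Expanding the square
  gives Ramanujan sums again, and the coefficient at a modulus \<open>d\<close> with prime set \<open>D\<close> is at most
  \<open>4 ^ card D\<close> times the mean value. The large sieve
  inequality bounds the sum over \<open>d\<close> of \<open>\<phi>(d)\<close> times the normalised Ramanujan sum, summed over all
  pairs \<open>(x, z)\<close>, by about \<open>2 N \<surd>(a b)\<close>; see \<open>sum_phi_char_avg_bilinear_le\<close>. As
  \<open>4 ^ card D \<le> \<phi>(d) / \<surd>Q\<close>, all moduli greater than one together contribute at most about
  \<open>2 N \<surd>(a b) / \<surd>Q \<le> 2 a b\<close> times the mean value, while the modulus one contributes exactly \<open>a b\<close>
  times the mean value. This is \<open>bilinear_selberg_sieve\<close>.

  It remains to bound the mean value, which is \<open>1 / sieve_mass\<close>. The harmonic sum up to \<open>R\<close> is at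
  most \<open>2 \<Prod>\<^bsub>p\<le>Q\<^esub> (1 + 1 / p)\<close> times the sieve mass, and the product is \<open>O(log Q)\<close>; see
  \<open>sieve_mass_lower_bound\<close>. The powers of primes up to \<open>R\<close> are not covered by the
  majorant, but they are so few that a trivial estimate suffices for them.
\<close>

section \<open>Additive characters\<close>

definition unit_char :: "real \<Rightarrow> complex" where
  "unit_char t = cis (2 * pi * t)"

lemma norm_unit_char [simp]: "cmod (unit_char t) = 1"
  by (simp add: unit_char_def)

lemma unit_char_0 [simp]: "unit_char 0 = 1"
  by (simp add: unit_char_def)

lemma unit_char_add: "unit_char (s + t) = unit_char s * unit_char t"
  by (simp add: unit_char_def cis_mult distrib_left)

lemma unit_char_minus: "unit_char (- t) = cnj (unit_char t)"
  by (simp add: unit_char_def cis_cnj)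

lemma unit_char_diff: "unit_char (s - t) = unit_char s * cnj (unit_char t)"
  using unit_char_add[of s "- t"] by (simp add: unit_char_minus)

lemma unit_char_power: "unit_char t ^ n = unit_char (real n * t)"
  by (induction n) (simp_all add: unit_char_add distrib_right)

lemma unit_char_sum: "finite A \<Longrightarrow> unit_char (\<Sum>i\<in>A. f i) = (\<Prod>i\<in>A. unit_char (f i))"
  by (induction A rule: finite_induct) (auto simp: unit_char_add)

lemma unit_char_eq_1_iff: "unit_char t = 1 \<longleftrightarrow> t \<in> \<int>"
proof
  assume "unit_char t = 1"
  then have "cos (2 * pi * t) = 1"
    by (simp add: unit_char_def complex_eq_iff)
  then obtain n :: int where "2 * pi * t = real_of_int n * 2 * pi"
    unfolding cos_one_2pi_int by auto
  then have "t = of_int n" by simp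
  then show "t \<in> \<int>" by simp
next
  assume "t \<in> \<int>"
  then show "unit_char t = 1"
    by (auto simp: unit_char_def elim!: Ints_cases)
qed

text \<open>
  A full period of length \<open>m\<close> sums to zero, so only an incomplete period counts.
\<close>

lemma norm_geometric_sum_root_of_unity_le:
  fixes w :: complex
  assumes "w ^ m = 1" "w \<noteq> 1" "m > 0"
  shows "cmod (\<Sum>k<n. w ^ k) \<le> real m"
proof (induction n rule: less_induct)
  case (less n)
  have nw: "cmod w = 1"
    using assms by (metis power_eq_1_iff less_numeral_extra(3))
  show ?case
  proof (cases "n < m")
    case True
    have "cmod (\<Sum>k<n. w ^ k) \<le> (\<Sum>k<n. 1)"
      using nw by (intro sum_norm_le) (simp add: norm_power)
    then show ?thesis using True by simp
  next
    case False
    then obtain j where n: "n = m + j" using le_Suc_ex linorder_not_less by blast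
    have zero: "(\<Sum>k<m. w ^ k) = 0"
      using assms by (simp add: geometric_sum)
    have "(\<Sum>k<n. w ^ k) = (\<Sum>k<m. w ^ k) + (\<Sum>k<j. w ^ (m + k))"
      unfolding n by (induction j) (auto simp: algebra_simps)
    also have "\<dots> = (\<Sum>k<j. w ^ k)"
      using assms(1) zero by (simp add: power_add)
    finally show ?thesis
      using less.IH[of j] n \<open>m > 0\<close> by simp
  qed
qed

text \<open>
  For a rational frequency this replaces the usual bound \<open>1 / \<parallel>\<theta>\<parallel>\<close>: a common denominator suffices as
  a measure of the spacing of the frequencies.
\<close>

lemma norm_sum_unit_char_interval_le:
  fixes M :: int
  assumes "\<theta> \<notin> \<int>" "real m * \<theta> \<in> \<int>" "m > 0"
  shows "cmod (\<Sum>z\<in>{M..<M + int N}. unit_char (\<theta> * of_int z)) \<le> real m"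
proof -
  have "(\<Sum>z\<in>{M..<M + int N}. unit_char (\<theta> * of_int z))
      = (\<Sum>k<N. unit_char (\<theta> * of_int (M + int k)))"
    by (rule sum.reindex_bij_witness[of _ "\<lambda>k. M + int k" "\<lambda>z. nat (z - M)"]) auto
  also have "\<dots> = unit_char (\<theta> * of_int M) * (\<Sum>k<N. unit_char \<theta> ^ k)"
    by (simp add: sum_distrib_left unit_char_power distrib_left unit_char_add mult_ac)
  finally show ?thesis
    using norm_geometric_sum_root_of_unity_le[of "unit_char \<theta>" m N] assms
    by (simp add: norm_mult unit_char_power unit_char_eq_1_iff)
qed


text \<open>
  The mean of the nontrivial additive characters modulo \<open>p\<close> at \<open>n\<close>, that is the Ramanujan sum
  \<open>c\<^sub>p(n)\<close> divided by \<open>\<phi>(p)\<close>.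
\<close>

definition local_char_avg :: "nat \<Rightarrow> int \<Rightarrow> real" where
  "local_char_avg p n = (if int p dvd n then 1 else - 1 / (real p - 1))"

text \<open>
  The Ramanujan sum \<open>c\<^sub>d(n)\<close> divided by \<open>\<phi>(d)\<close>, where \<open>d\<close> is the product of the primes in \<open>D\<close>.
  Squarefree moduli are represented throughout by their sets of prime factors, so that multiplicative
  manipulations become manipulations of products over finite sets.
\<close>

definition char_avg :: "nat set \<Rightarrow> int \<Rightarrow> real" where
  "char_avg D n = (\<Prod>p\<in>D. local_char_avg p n)"

definition phi :: "nat set \<Rightarrow> real" where
  "phi D = (\<Prod>p\<in>D. real p - 1)"

text \<open>
  By the Chinese remainder theorem, as \<open>a\<close> runs through \<open>residues_of D\<close> below, these are the reduced
  fractions modulo one with denominator \<open>\<Prod>D\<close>.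
\<close>

definition freq :: "nat set \<Rightarrow> (nat \<Rightarrow> nat) \<Rightarrow> real" where
  "freq D a = (\<Sum>p\<in>D. real (a p) / real p)"

abbreviation residues_of :: "nat set \<Rightarrow> (nat \<Rightarrow> nat) set" where
  "residues_of D \<equiv> PiE D (\<lambda>p. {1..<p})"

text \<open>
  The characters with \<open>a = 0, \<dots>, p - 1\<close> sum to \<open>p\<close> or to \<open>0\<close>; removing the trivial one gives
  \<open>p - 1\<close> or \<open>-1\<close>.
\<close>

lemma sum_unit_char_nonzero_residues:
  assumes "prime p"
  shows "(\<Sum>a\<in>{1..<p}. unit_char (real a / real p * of_int n))
    = of_real ((real p - 1) * local_char_avg p n)"
proof -
  have p: "p > 1" using assms prime_gt_1_nat by blast
  define w where "w = unit_char (of_int n / real p)"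
  have pw: "w ^ a = unit_char (real a / real p * of_int n)" for a
    by (simp add: w_def unit_char_power)
  have "w ^ p = unit_char (of_int n)" using p by (simp add: pw)
  then have wp: "w ^ p = 1" by (simp add: unit_char_eq_1_iff)
  have w1: "w = 1 \<longleftrightarrow> int p dvd n"
    unfolding w_def unit_char_eq_1_iff
    using p of_int_div_of_int_in_Ints_iff[of n "int p", where ?'a = real] by simp
  have "{..<p} = insert 0 {1..<p}" using p by auto
  then have split: "(\<Sum>a<p. w ^ a) = 1 + (\<Sum>a\<in>{1..<p}. w ^ a)" by simp
  show ?thesis
  proof (cases "int p dvd n")
    case True
    with w1 have "w = 1" by simp
    then have "(\<Sum>a\<in>{1..<p}. w ^ a) = of_real (real p - 1)"
      using p by (simp add: of_nat_diff)
    then show ?thesis using True by (simp add: pw local_char_avg_def)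
  next
    case False
    then have "w \<noteq> 1" using w1 by simp
    then have "(\<Sum>a<p. w ^ a) = 0" using wp by (simp add: geometric_sum)
    then have "(\<Sum>a\<in>{1..<p}. w ^ a) = -1" using split by (simp add: add_eq_0_iff)
    then show ?thesis using False p by (simp add: pw local_char_avg_def)
  qed
qed

text \<open>
  Multiplying out the local identities gives the expansion of the Ramanujan sum into characters.
\<close>

lemma phi_char_avg_eq_sum_unit_char:
  assumes "finite D" "\<And>p. p \<in> D \<Longrightarrow> prime p"
  shows "of_real (phi D * char_avg D n) = (\<Sum>a\<in>residues_of D. unit_char (freq D a * of_int n))"
proof -
  have "of_real (phi D * char_avg D n)
      = (\<Prod>p\<in>D. \<Sum>a\<in>{1..<p}. unit_char (real a / real p * of_int n))"
    unfolding phi_def char_avg_def prod.distrib[symmetric] of_real_prod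
    by (intro prod.cong refl sum_unit_char_nonzero_residues[symmetric] assms(2))
  also have "\<dots> = (\<Sum>a\<in>residues_of D. \<Prod>p\<in>D. unit_char (real (a p) / real p * of_int n))"
    using assms(1) by (rule prod_sum_PiE) simp
  also have "\<dots> = (\<Sum>a\<in>residues_of D. unit_char (freq D a * of_int n))"
    using assms(1) by (simp add: freq_def sum_distrib_right unit_char_sum)
  finally show ?thesis .
qed

lemma prod_times_freq_in_Ints:
  assumes "finite D" "\<And>p. p \<in> D \<Longrightarrow> p > 0"
  shows "real (\<Prod>D) * freq D a \<in> \<int>"
proof -
  have "real (\<Prod>D) * (real (a p) / real p) \<in> \<int>" if "p \<in> D" for p
  proof -
    have "\<Prod>D = p * \<Prod>(D - {p})" using that assms(1) by (simp add: prod.remove)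
    then have "real (\<Prod>D) * (real (a p) / real p) = real (\<Prod>(D - {p}) * a p)"
      using assms(2)[OF that] by simp
    then show ?thesis by (metis Ints_of_nat)
  qed
  then show ?thesis by (auto simp: freq_def sum_distrib_left intro!: Ints_sum)
qed

text \<open>
  Extend \<open>a\<close> and \<open>b\<close> by zero and choose a prime \<open>p\<close> at which they differ. The terms of the other
  primes lose their denominators on multiplication by a number prime to \<open>p\<close>, while the term of \<open>p\<close>
  has a numerator that is not divisible by \<open>p\<close>.
\<close>

lemma freq_diff_notin_Ints:
  assumes fin: "finite D" "finite E"
    and primes: "\<And>p. p \<in> D \<union> E \<Longrightarrow> prime p"
    and a: "a \<in> residues_of D" and b: "b \<in> residues_of E"
    and neq: "(D, a) \<noteq> (E, b)"
  shows "freq D a - freq E b \<notin> \<int>"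
proof
  assume int: "freq D a - freq E b \<in> \<int>"
  define a' where "a' p = (if p \<in> D then a p else 0)" for p
  define b' where "b' p = (if p \<in> E then b p else 0)" for p
  define U where "U = D \<union> E"
  have finU: "finite U" using fin by (simp add: U_def)
  have a'D: "a' p \<noteq> 0 \<longleftrightarrow> p \<in> D" and b'E: "b' p \<noteq> 0 \<longleftrightarrow> p \<in> E" for p
    using a b by (auto simp: a'_def b'_def PiE_iff)
  have "\<exists>p. a' p \<noteq> b' p"
  proof (rule ccontr)
    assume "\<not> ?thesis"
    then have eq: "a' = b'" by auto
    then have "D = E" using a'D b'E by (metis subsetI subset_antisym)
    moreover have "a p = b p" for p
      using eq a b \<open>D = E\<close> unfolding a'_def b'_def by (metis PiE_E)
    ultimately show False using neq by auto
  qed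
  then obtain p where p: "a' p \<noteq> b' p" by blast
  then have pU: "p \<in> U" by (auto simp: a'_def b'_def U_def split: if_splits)
  then have pp: "prime p" using primes by (simp add: U_def)
  have small: "a' p < p" "b' p < p"
    using a b pp prime_gt_0_nat by (auto simp: a'_def b'_def PiE_iff)
  have fa: "freq D a = (\<Sum>q\<in>U. real (a' q) / real q)"
    unfolding freq_def U_def a'_def using fin by (intro sum.mono_neutral_cong_left) auto
  have fb: "freq E b = (\<Sum>q\<in>U. real (b' q) / real q)"
    unfolding freq_def U_def b'_def using fin by (intro sum.mono_neutral_cong_left) auto
  define M where "M = \<Prod>(U - {p})"
  define r where "r = (\<Sum>q\<in>U - {p}. real (a' q) / real q) - (\<Sum>q\<in>U - {p}. real (b' q) / real q)"
  have "freq D a - freq E b = (real (a' p) / real p - real (b' p) / real p) + r"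
    unfolding fa fb r_def using finU pU by (simp add: sum.remove)
  moreover have Mr: "real M * r \<in> \<int>"
    unfolding r_def right_diff_distrib M_def
    using prod_times_freq_in_Ints[of "U - {p}" a'] prod_times_freq_in_Ints[of "U - {p}" b'] finU primes
    by (auto simp: freq_def U_def prime_gt_0_nat)
  moreover have "real M * (freq D a - freq E b) \<in> \<int>"
    using int by simp
  ultimately have "real M * (real (a' p) / real p - real (b' p) / real p) \<in> \<int>"
    by (metis Ints_diff add_diff_cancel_right' distrib_left)
  then obtain k where "real M * (real (a' p) / real p - real (b' p) / real p) = of_int k"
    by (auto elim: Ints_cases)
  then have "real M * (real (a' p) - real (b' p)) = real p * of_int k"
    using pp prime_gt_0_nat by (simp add: field_simps)
  then have "real_of_int (int M * (int (a' p) - int (b' p))) = real_of_int (int p * k)"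
    by simp
  then have "int M * (int (a' p) - int (b' p)) = int p * k"
    by (simp only: of_int_eq_iff)
  then have "int p dvd int M * (int (a' p) - int (b' p))" by simp
  then have "int p dvd int M \<or> int p dvd int (a' p) - int (b' p)"
    using pp by (simp add: prime_dvd_mult_iff)
  moreover have "\<not> int p dvd int M"
  proof
    assume "int p dvd int M"
    then have "p dvd \<Prod>(U - {p})" unfolding M_def int_dvd_int_iff .
    then obtain q where "q \<in> U - {p}" "p dvd q"
      using pp finU by (auto simp: prime_dvd_prod_iff)
    then show False using primes pp primes_dvd_imp_eq[of p q] by (auto simp: U_def)
  qed
  moreover have "\<not> int p dvd int (a' p) - int (b' p)"
    using small p zdvd_not_zless[of "\<bar>int (a' p) - int (b' p)\<bar>" "int p"] by auto
  ultimately show False by blast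
qed

section \<open>The large sieve inequality\<close>

text \<open>
  The duality argument. The left-hand side \<open>X\<close> is the inner product of \<open>f\<close> with the dual sum
  \<open>V(z) = \<Sum>\<^sub>j cnj (S\<^sub>j) e(\<alpha>\<^sub>j z)\<close>, where \<open>S\<^sub>j\<close> is the exponential sum at \<open>\<alpha>\<^sub>j\<close>. The square norm of
  \<open>V\<close> is a quadratic form in the \<open>S\<^sub>j\<close> whose matrix has absolute row sums at most \<open>\<Delta>\<close>, so it is at
  most \<open>\<Delta> X\<close>, and the Cauchy-Schwarz inequality gives \<open>X\<^sup>2 \<le> \<parallel>f\<parallel>\<^sup>2 \<Delta> X\<close>.
\<close>

lemma large_sieve_if_row_sums_le:
  fixes I :: "int set" and f :: "int \<Rightarrow> complex" and \<alpha> :: "'j \<Rightarrow> real"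
  assumes "\<Delta> \<ge> 0"
    and row: "\<And>j. j \<in> J \<Longrightarrow>
    (\<Sum>k\<in>J. cmod (\<Sum>z\<in>I. unit_char ((\<alpha> j - \<alpha> k) * of_int z))) \<le> \<Delta>"
  shows "(\<Sum>j\<in>J. (cmod (\<Sum>z\<in>I. f z * unit_char (\<alpha> j * of_int z)))\<^sup>2)
    \<le> \<Delta> * (\<Sum>z\<in>I. (cmod (f z))\<^sup>2)"
proof -
  define S where "S j = (\<Sum>z\<in>I. f z * unit_char (\<alpha> j * of_int z))" for j
  define V where "V z = (\<Sum>j\<in>J. cnj (S j) * unit_char (\<alpha> j * of_int z))" for z
  define X where "X = (\<Sum>j\<in>J. (cmod (S j))\<^sup>2)"
  define K where "K j k = (\<Sum>z\<in>I. unit_char ((\<alpha> j - \<alpha> k) * of_int z))" for j k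
  have "complex_of_real X = (\<Sum>j\<in>J. cnj (S j) * S j)"
    unfolding X_def by (simp add: complex_norm_square mult.commute del: of_real_power)
  also have "\<dots> = (\<Sum>z\<in>I. f z * V z)"
  proof -
    have "(\<Sum>j\<in>J. cnj (S j) * S j)
        = (\<Sum>j\<in>J. \<Sum>z\<in>I. f z * (cnj (S j) * unit_char (\<alpha> j * of_int z)))"
      by (intro sum.cong refl, subst (2) S_def) (simp add: sum_distrib_left mult_ac)
    also have "\<dots> = (\<Sum>z\<in>I. \<Sum>j\<in>J. f z * (cnj (S j) * unit_char (\<alpha> j * of_int z)))"
      by (rule sum.swap)
    finally show ?thesis by (simp add: V_def sum_distrib_left)
  qed
  finally have X1: "complex_of_real X = (\<Sum>z\<in>I. f z * V z)" .
  have X0: "X \<ge> 0" unfolding X_def by (simp add: sum_nonneg)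
  have "X = cmod (complex_of_real X)" using X0 by simp
  also have "\<dots> \<le> (\<Sum>z\<in>I. cmod (f z) * cmod (V z))"
    unfolding X1 by (rule sum_norm_le) (simp add: norm_mult)
  finally have "X\<^sup>2 \<le> (\<Sum>z\<in>I. cmod (f z) * cmod (V z))\<^sup>2"
    using X0 by (simp add: power_mono)
  also have "\<dots> \<le> (\<Sum>z\<in>I. (cmod (f z))\<^sup>2) * (\<Sum>z\<in>I. (cmod (V z))\<^sup>2)"
    by (rule Cauchy_Schwarz_ineq_sum)
  finally have X2: "X\<^sup>2 \<le> (\<Sum>z\<in>I. (cmod (f z))\<^sup>2) * (\<Sum>z\<in>I. (cmod (V z))\<^sup>2)" .
  have Ksym: "cmod (K j k) = cmod (K k j)" for j k
  proof -
    have "K j k = cnj (K k j)"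
      unfolding K_def by (simp add: unit_char_minus[symmetric] algebra_simps)
    then show ?thesis by simp
  qed
  have "complex_of_real (\<Sum>z\<in>I. (cmod (V z))\<^sup>2) = (\<Sum>z\<in>I. V z * cnj (V z))"
    by (simp add: complex_norm_square del: of_real_power)
  also have "\<dots> = (\<Sum>z\<in>I. \<Sum>j\<in>J. \<Sum>k\<in>J. cnj (S j) * S k * unit_char ((\<alpha> j - \<alpha> k) * of_int z))"
  proof (intro sum.cong refl)
    fix z
    have "V z * cnj (V z) = (\<Sum>j\<in>J. \<Sum>k\<in>J. (cnj (S j) * unit_char (\<alpha> j * of_int z))
        * cnj (cnj (S k) * unit_char (\<alpha> k * of_int z)))"
      unfolding V_def by (simp only: sum_product cnj_sum)
    moreover have "unit_char ((\<alpha> j - \<alpha> k) * of_int z)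
        = unit_char (\<alpha> j * of_int z) * cnj (unit_char (\<alpha> k * of_int z))" for j k
      by (simp add: left_diff_distrib unit_char_diff)
    ultimately show "V z * cnj (V z)
        = (\<Sum>j\<in>J. \<Sum>k\<in>J. cnj (S j) * S k * unit_char ((\<alpha> j - \<alpha> k) * of_int z))"
      by (simp add: mult_ac)
  qed
  also have "\<dots> = (\<Sum>j\<in>J. \<Sum>k\<in>J. \<Sum>z\<in>I. cnj (S j) * S k * unit_char ((\<alpha> j - \<alpha> k) * of_int z))"
    by (subst sum.swap, intro sum.cong refl, rule sum.swap)
  also have "\<dots> = (\<Sum>j\<in>J. \<Sum>k\<in>J. cnj (S j) * S k * K j k)"
    unfolding K_def by (simp add: sum_distrib_left)
  finally have "(\<Sum>z\<in>I. (cmod (V z))\<^sup>2) = cmod (\<Sum>j\<in>J. \<Sum>k\<in>J. cnj (S j) * S k * K j k)"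
    by (metis (no_types, lifting) abs_of_nonneg norm_of_real sum_nonneg zero_le_power2)
  also have "\<dots> \<le> (\<Sum>j\<in>J. \<Sum>k\<in>J. cmod (S j) * cmod (S k) * cmod (K j k))"
    by (intro sum_norm_le) (simp add: norm_mult)
  also have "\<dots> \<le> (\<Sum>j\<in>J. \<Sum>k\<in>J. ((cmod (S j))\<^sup>2 + (cmod (S k))\<^sup>2) / 2 * cmod (K j k))"
  proof (intro sum_mono mult_right_mono norm_ge_zero)
    fix j k
    show "cmod (S j) * cmod (S k) \<le> ((cmod (S j))\<^sup>2 + (cmod (S k))\<^sup>2) / 2"
      using sum_squares_bound[of "cmod (S j)" "cmod (S k)"] by simp
  qed
  also have "\<dots> = (\<Sum>j\<in>J. \<Sum>k\<in>J. (cmod (S j))\<^sup>2 / 2 * cmod (K j k))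
      + (\<Sum>j\<in>J. \<Sum>k\<in>J. (cmod (S k))\<^sup>2 / 2 * cmod (K j k))"
    by (simp add: sum.distrib add_divide_distrib distrib_right)
  also have "(\<Sum>j\<in>J. \<Sum>k\<in>J. (cmod (S k))\<^sup>2 / 2 * cmod (K j k))
      = (\<Sum>j\<in>J. \<Sum>k\<in>J. (cmod (S j))\<^sup>2 / 2 * cmod (K j k))"
    by (subst sum.swap) (simp add: Ksym)
  also have "(\<Sum>j\<in>J. \<Sum>k\<in>J. (cmod (S j))\<^sup>2 / 2 * cmod (K j k)) + \<dots>
      = (\<Sum>j\<in>J. (cmod (S j))\<^sup>2 * (\<Sum>k\<in>J. cmod (K j k)))"
    by (simp add: sum_distrib_left flip: sum.distrib) (simp add: mult.commute)
  also have "\<dots> \<le> (\<Sum>j\<in>J. (cmod (S j))\<^sup>2 * \<Delta>)"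
    using row by (intro sum_mono mult_left_mono) (auto simp: K_def)
  also have "\<dots> = X * \<Delta>"
    by (simp add: X_def sum_distrib_right)
  finally have V: "(\<Sum>z\<in>I. (cmod (V z))\<^sup>2) \<le> X * \<Delta>" .
  have "X * X \<le> X * (\<Delta> * (\<Sum>z\<in>I. (cmod (f z))\<^sup>2))"
    using order.trans[OF X2 mult_left_mono[OF V]]
    by (simp add: sum_nonneg power2_eq_square mult_ac)
  then have "X \<le> \<Delta> * (\<Sum>z\<in>I. (cmod (f z))\<^sup>2)" if "X > 0"
    using that by simp
  moreover have "0 \<le> \<Delta> * (\<Sum>z\<in>I. (cmod (f z))\<^sup>2)"
    using \<open>\<Delta> \<ge> 0\<close> by (simp add: sum_nonneg)
  ultimately show ?thesis using X0 unfolding X_def S_def by fastforce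
qed

text \<open>
  A set of primes consists of the prime divisors of its product.
\<close>

lemma prime_sets_eq_if_prod_eq:
  assumes "finite D" "finite E" "\<And>p. p \<in> D \<union> E \<Longrightarrow> prime (p::nat)" "\<Prod>D = \<Prod>E"
  shows "D = E"
proof -
  have *: "p \<in> A \<longleftrightarrow> prime p \<and> p dvd \<Prod>A"
    if "finite A" "\<And>p. p \<in> A \<Longrightarrow> prime p" for A :: "nat set" and p
    using that primes_dvd_imp_eq[of p]
    by (metis (full_types) dvd_refl prime_dvd_prod_iff)
  show ?thesis
  proof (rule set_eqI)
    fix p
    have "p \<in> D \<longleftrightarrow> prime p \<and> p dvd \<Prod>D" using assms(1,3) by (intro *) auto
    moreover have "p \<in> E \<longleftrightarrow> prime p \<and> p dvd \<Prod>E" using assms(2,3) by (intro *) auto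
    ultimately show "p \<in> D \<longleftrightarrow> p \<in> E" using assms(4) by simp
  qed
qed

lemma card_prime_sets_le:
  assumes "finite \<D>" "\<And>D. D \<in> \<D> \<Longrightarrow> finite D \<and> (\<forall>p\<in>D. prime p) \<and> \<Prod>D \<le> (K::nat)"
  shows "card \<D> \<le> K"
proof -
  have "inj_on (\<lambda>D. \<Prod>D) \<D>"
    using assms(2) by (intro inj_onI prime_sets_eq_if_prod_eq) auto
  moreover have "(\<lambda>D. \<Prod>D) ` \<D> \<subseteq> {1..K}"
    using assms(2) by (force simp: Suc_le_eq intro!: prod_pos prime_gt_0_nat)
  ultimately show ?thesis
    using card_inj_on_le[of "\<lambda>D. \<Prod>D" \<D> "{1..K}"] by simp
qed

lemma card_freqs_le:
  assumes "finite \<D>" "\<And>D. D \<in> \<D> \<Longrightarrow> finite D \<and> (\<forall>p\<in>D. prime p) \<and> \<Prod>D \<le> (K::nat)"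
  shows "card (Sigma \<D> residues_of) \<le> K\<^sup>2"
proof -
  have "card (Sigma \<D> residues_of) = (\<Sum>D\<in>\<D>. \<Prod>p\<in>D. p - 1)"
    using assms by (subst card_SigmaI) (auto simp: card_PiE intro!: finite_PiE sum.cong)
  also have "\<dots> \<le> (\<Sum>D\<in>\<D>. K)"
  proof (intro sum_mono)
    fix D assume "D \<in> \<D>"
    have "(\<Prod>p\<in>D. p - 1) \<le> \<Prod>D" by (intro prod_mono) auto
    then show "(\<Prod>p\<in>D. p - 1) \<le> K" using assms(2)[OF \<open>D \<in> \<D>\<close>] by simp
  qed
  also have "\<dots> \<le> K * K" using card_prime_sets_le[OF assms] by simp
  finally show ?thesis by (simp add: power2_eq_square)
qed

text \<open>
  Two different frequencies have a difference with denominator at most \<open>K\<^sup>2\<close>, and there are at most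
  \<open>K\<^sup>2\<close> frequencies, so the off-diagonal terms of a row contribute at most \<open>K ^ 4\<close>. The exponent is
  far from optimal, but \<open>K\<close> will be a small power of \<open>N\<close>.
\<close>

lemma large_sieve_prime_sets:
  fixes M :: int and N K :: nat and f :: "int \<Rightarrow> complex"
  assumes fin: "finite \<D>"
    and \<D>: "\<And>D. D \<in> \<D> \<Longrightarrow> finite D \<and> (\<forall>p\<in>D. prime p) \<and> \<Prod>D \<le> K"
  defines "I \<equiv> {M..<M + int N}"
  shows "(\<Sum>D\<in>\<D>. \<Sum>a\<in>residues_of D. (cmod (\<Sum>z\<in>I. f z * unit_char (freq D a * of_int z)))\<^sup>2)
    \<le> (real N + real K ^ 4) * (\<Sum>z\<in>I. (cmod (f z))\<^sup>2)"
proof -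
  define J where "J = Sigma \<D> residues_of"
  define \<alpha> where "\<alpha> = (\<lambda>(D, a). freq D a)"
  have finJ: "finite J"
    unfolding J_def using fin \<D> by (intro finite_SigmaI finite_PiE) auto
  have cJ: "card J \<le> K\<^sup>2" unfolding J_def using fin \<D> by (rule card_freqs_le)
  have row: "(\<Sum>k\<in>J. cmod (\<Sum>z\<in>I. unit_char ((\<alpha> j - \<alpha> k) * of_int z))) \<le> real N + real K ^ 4"
    if j: "j \<in> J" for j
  proof -
    have off: "cmod (\<Sum>z\<in>I. unit_char ((\<alpha> j - \<alpha> k) * of_int z)) \<le> real (K\<^sup>2)"
      if k: "k \<in> J - {j}" for k
    proof -
      obtain D a where Da: "j = (D, a)" "D \<in> \<D>" "a \<in> residues_of D" using j unfolding J_def by blast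
      obtain E b where Eb: "k = (E, b)" "E \<in> \<D>" "b \<in> residues_of E" using k unfolding J_def by blast
      note D = \<D>[OF Da(2)] and E = \<D>[OF Eb(2)]
      define m where "m = \<Prod>D * \<Prod>E"
      have "real m * (freq D a - freq E b)
          = real (\<Prod>E) * (real (\<Prod>D) * freq D a) - real (\<Prod>D) * (real (\<Prod>E) * freq E b)"
        by (simp add: m_def algebra_simps)
      also have "\<dots> \<in> \<int>"
        using D E prime_gt_0_nat
        by (intro Ints_diff Ints_mult prod_times_freq_in_Ints Ints_of_nat) auto
      finally have "real m * (freq D a - freq E b) \<in> \<int>" .
      moreover have "freq D a - freq E b \<notin> \<int>"
        using D E Da Eb k by (intro freq_diff_notin_Ints) auto
      moreover have "m > 0"
        unfolding m_def using D E prime_gt_0_nat by (auto intro!: prod_pos)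
      ultimately have "cmod (\<Sum>z\<in>I. unit_char ((freq D a - freq E b) * of_int z)) \<le> real m"
        unfolding I_def by (intro norm_sum_unit_char_interval_le)
      also have "m \<le> K\<^sup>2"
        unfolding m_def power2_eq_square using D E by (intro mult_mono) auto
      finally show ?thesis by (simp add: \<alpha>_def Da Eb)
    qed
    have "(\<Sum>k\<in>J. cmod (\<Sum>z\<in>I. unit_char ((\<alpha> j - \<alpha> k) * of_int z)))
        = real N + (\<Sum>k\<in>J - {j}. cmod (\<Sum>z\<in>I. unit_char ((\<alpha> j - \<alpha> k) * of_int z)))"
      using finJ j by (simp add: sum.remove I_def)
    also have "\<dots> \<le> real N + real (card (J - {j})) * real (K\<^sup>2)"
      by (intro add_left_mono sum_bounded_above off)
    also have "\<dots> \<le> real N + real (K\<^sup>2) * real (K\<^sup>2)"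
    proof -
      have "card (J - {j}) \<le> K\<^sup>2" using cJ card_Diff1_le[of J j] by linarith
      then show ?thesis by (intro add_left_mono mult_right_mono) auto
    qed
    also have "\<dots> = real N + real K ^ 4" by (simp add: power_mult[symmetric] flip: power_add)
    finally show ?thesis .
  qed
  have "(\<Sum>j\<in>J. (cmod (\<Sum>z\<in>I. f z * unit_char (\<alpha> j * of_int z)))\<^sup>2)
      \<le> (real N + real K ^ 4) * (\<Sum>z\<in>I. (cmod (f z))\<^sup>2)"
    using finJ row by (intro large_sieve_if_row_sums_le) (auto simp: I_def)
  moreover have "(\<Sum>j\<in>J. (cmod (\<Sum>z\<in>I. f z * unit_char (\<alpha> j * of_int z)))\<^sup>2)
     = (\<Sum>D\<in>\<D>. \<Sum>a\<in>residues_of D. (cmod (\<Sum>z\<in>I. f z * unit_char (freq D a * of_int z)))\<^sup>2)"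
    unfolding J_def \<alpha>_def using fin \<D>
    by (subst sum.Sigma) (auto intro!: finite_PiE sum.cong)
  ultimately show ?thesis by simp
qed

text \<open>
  Expanded into characters, the term of \<open>D\<close> is a sum of products of exponential sums over \<open>G\<close> and
  over \<open>F\<close>. The Cauchy-Schwarz inequality and the large sieve for each of the two sets give the bound.
\<close>

lemma sum_phi_char_avg_bilinear_le:
  fixes M :: int and N K :: nat
  assumes fin: "finite \<D>"
    and \<D>: "\<And>D. D \<in> \<D> \<Longrightarrow> finite D \<and> (\<forall>p\<in>D. prime p) \<and> \<Prod>D \<le> K"
    and F: "F \<subseteq> {M..<M + int N}" and G: "G \<subseteq> {M..<M + int N}"
  shows "(\<Sum>D\<in>\<D>. phi D * \<bar>\<Sum>x\<in>G. \<Sum>z\<in>F. char_avg D (x - z)\<bar>)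
    \<le> (real N + real K ^ 4) * sqrt (real (card F) * real (card G))"
proof -
  define I where "I = {M..<M + int N}"
  define J where "J = Sigma \<D> residues_of"
  define S where "S A = (\<lambda>(D, a). \<Sum>z\<in>A. unit_char (freq D a * of_int z))" for A
  have finJ: "finite J"
    unfolding J_def using fin \<D> by (intro finite_SigmaI finite_PiE) auto
  have bound: "(\<Sum>j\<in>J. (cmod (S A j))\<^sup>2) \<le> (real N + real K ^ 4) * real (card A)"
    if A: "A \<subseteq> I" for A
  proof -
    have finI: "finite I" by (simp add: I_def)
    have S: "S A (D, a) = (\<Sum>z\<in>I. indicator A z * unit_char (freq D a * of_int z))" for D a
      using A finI unfolding S_def
      by (auto simp: indicator_def intro!: sum.mono_neutral_cong_left)
    have "(\<Sum>z\<in>I. (cmod (indicator A z))\<^sup>2) = (\<Sum>z\<in>I. if z \<in> A then 1 else 0)"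
      by (intro sum.cong) (auto simp: indicator_def)
    also have "\<dots> = real (card A)"
      using A finI by (simp add: sum.If_cases Int_absorb1)
    finally have "(\<Sum>D\<in>\<D>. \<Sum>a\<in>residues_of D. (cmod (S A (D, a)))\<^sup>2)
        \<le> (real N + real K ^ 4) * real (card A)"
      using large_sieve_prime_sets[OF fin \<D>, where M = M and N = N and f = "indicator A"] unfolding S I_def by simp
    then show ?thesis
      unfolding J_def using fin \<D> by (subst (asm) sum.Sigma) (auto intro!: finite_PiE)
  qed
  have block: "phi D * \<bar>\<Sum>x\<in>G. \<Sum>z\<in>F. char_avg D (x - z)\<bar>
      \<le> (\<Sum>a\<in>residues_of D. cmod (S G (D, a)) * cmod (S F (D, a)))" if D: "D \<in> \<D>" for D
  proof -
    have phi: "phi D \<ge> 0"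
      unfolding phi_def using \<D>[OF D] prime_gt_0_nat
      by (intro prod_nonneg) (force simp: Suc_le_eq)
    have "complex_of_real (phi D * (\<Sum>x\<in>G. \<Sum>z\<in>F. char_avg D (x - z)))
        = (\<Sum>x\<in>G. \<Sum>z\<in>F. of_real (phi D * char_avg D (x - z)))"
      by (simp add: sum_distrib_left)
    also have "\<dots> = (\<Sum>x\<in>G. \<Sum>z\<in>F. \<Sum>a\<in>residues_of D. unit_char (freq D a * of_int (x - z)))"
      using \<D>[OF D] phi_char_avg_eq_sum_unit_char[of D] by (intro sum.cong refl) blast
    also have "\<dots> = (\<Sum>a\<in>residues_of D. \<Sum>x\<in>G. \<Sum>z\<in>F. unit_char (freq D a * of_int (x - z)))"
      by (subst sum.swap, subst sum.swap[of _ _ G]) (intro sum.cong refl sum.swap)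
    also have "\<dots> = (\<Sum>a\<in>residues_of D. S G (D, a) * cnj (S F (D, a)))"
      by (simp add: S_def sum_product right_diff_distrib unit_char_diff)
    finally have eq: "complex_of_real (phi D * (\<Sum>x\<in>G. \<Sum>z\<in>F. char_avg D (x - z)))
        = (\<Sum>a\<in>residues_of D. S G (D, a) * cnj (S F (D, a)))" .
    have "phi D * \<bar>\<Sum>x\<in>G. \<Sum>z\<in>F. char_avg D (x - z)\<bar>
        = cmod (complex_of_real (phi D * (\<Sum>x\<in>G. \<Sum>z\<in>F. char_avg D (x - z))))"
      using phi by (simp only: norm_of_real abs_mult abs_of_nonneg)
    also have "\<dots> \<le> (\<Sum>a\<in>residues_of D. cmod (S G (D, a)) * cmod (S F (D, a)))"
      unfolding eq by (rule sum_norm_le) (simp add: norm_mult)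
    finally show ?thesis .
  qed
  have "(\<Sum>D\<in>\<D>. phi D * \<bar>\<Sum>x\<in>G. \<Sum>z\<in>F. char_avg D (x - z)\<bar>)
      \<le> (\<Sum>D\<in>\<D>. \<Sum>a\<in>residues_of D. cmod (S G (D, a)) * cmod (S F (D, a)))"
    by (intro sum_mono block)
  also have "\<dots> = (\<Sum>j\<in>J. cmod (S G j) * cmod (S F j))"
    unfolding J_def using fin \<D> by (subst sum.Sigma) (auto intro!: finite_PiE sum.cong)
  also have "\<dots> \<le> sqrt ((\<Sum>j\<in>J. (cmod (S G j))\<^sup>2) * (\<Sum>j\<in>J. (cmod (S F j))\<^sup>2))"
    by (intro real_le_rsqrt Cauchy_Schwarz_ineq_sum)
  also have "\<dots> \<le> sqrt (((real N + real K ^ 4) * real (card G)) * ((real N + real K ^ 4) * real (card F)))"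
    using F G by (intro real_sqrt_le_mono mult_mono bound) (auto simp: I_def sum_nonneg)
  also have "\<dots> = sqrt ((real N + real K ^ 4)\<^sup>2 * (real (card F) * real (card G)))"
    by (simp add: power2_eq_square mult_ac)
  also have "\<dots> = (real N + real K ^ 4) * sqrt (real (card F) * real (card G))"
    by (simp add: real_sqrt_mult)
  finally show ?thesis .
qed

section \<open>A bilinear Selberg sieve\<close>

definition sieve_support :: "nat set \<Rightarrow> nat \<Rightarrow> nat set set" where
  "sieve_support P R = {A. A \<subseteq> P \<and> \<Prod>A \<le> R}"

text \<open>
  The optimal weights of Selberg's sieve, up to normalisation, in terms of Ramanujan sums instead of
  divisors: this is \<open>\<Sum>\<^sub>d \<mu>(d) c\<^sub>d(n) / \<phi>(d)\<close>, where \<open>d \<le> R\<close> is composed of primes in \<open>P\<close>.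
\<close>

definition selberg_sum :: "nat set \<Rightarrow> nat \<Rightarrow> int \<Rightarrow> real" where
  "selberg_sum P R n = (\<Sum>A\<in>sieve_support P R. (-1) ^ card A * char_avg A n)"

text \<open>
  The main term \<open>\<Sum>\<^sub>d 1 / \<phi>(d)\<close> of Selberg's sieve.
\<close>

definition sieve_mass :: "nat set \<Rightarrow> nat \<Rightarrow> real" where
  "sieve_mass P R = (\<Sum>A\<in>sieve_support P R. 1 / phi A)"

lemma finite_sieve_support: "finite P \<Longrightarrow> finite (sieve_support P R)"
  unfolding sieve_support_def by (rule finite_subset[of _ "Pow P"]) auto

lemma phi_ge_1: "(\<And>p. p \<in> D \<Longrightarrow> prime p) \<Longrightarrow> phi D \<ge> 1"
  unfolding phi_def by (intro prod_ge_1) (metis prime_ge_2_nat of_nat_mono of_nat_numeral le_diff_eq one_add_one)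

lemma sieve_support_mono:
  assumes "A \<in> sieve_support P R" "B \<subseteq> A" "finite P" "\<And>p. p \<in> P \<Longrightarrow> prime p"
  shows "B \<in> sieve_support P R"
proof -
  have A: "A \<subseteq> P" "\<Prod>A \<le> R" using assms by (auto simp: sieve_support_def)
  have fin: "finite A" using A assms finite_subset by blast
  have "\<Prod>B dvd \<Prod>A" using fin assms(2) by (intro prod_dvd_prod_subset)
  moreover have "\<Prod>A > 0"
    using A(1) assms(4) prime_gt_0_nat by (intro prod_pos) blast
  ultimately have "\<Prod>B \<le> R" using A(2) dvd_imp_le order.trans by blast
  then show ?thesis using A assms by (auto simp: sieve_support_def)
qed

lemma char_avg_union:
  "finite A \<Longrightarrow> finite B \<Longrightarrow> A \<inter> B = {} \<Longrightarrow> char_avg (A \<union> B) n = char_avg A n * char_avg B n"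
  by (simp add: char_avg_def prod.union_disjoint)

text \<open>
  The local part of the convolution of the Fourier expansion with itself.
\<close>

lemma local_char_avg_square:
  assumes "prime p"
  shows "(local_char_avg p n)\<^sup>2
    = (real p - 2) / (real p - 1) * local_char_avg p n + 1 / (real p - 1)"
proof -
  define q where "q = real p - 1"
  have "q > 0" using assms prime_gt_1_nat unfolding q_def by fastforce
  moreover have "real p = q + 1" by (simp add: q_def)
  ultimately show ?thesis
    by (auto simp: local_char_avg_def divide_simps) (auto simp: power2_eq_square algebra_simps)
qed

text \<open>
  A prime that divides only one of the two moduli survives. A common prime either survives or is
  absorbed into the coefficient, and \<open>f\<close> is the set of surviving common primes.
\<close>

lemma char_avg_mult:
  assumes "finite A" "finite B" "\<And>p. p \<in> A \<union> B \<Longrightarrow> prime p"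
  shows "char_avg A n * char_avg B n
    = (\<Sum>f\<in>Pow (A \<inter> B). (\<Prod>p\<in>f. (real p - 2) / (real p - 1)) * (1 / phi (A \<inter> B - f))
        * char_avg ((A - B) \<union> (B - A) \<union> f) n)"
proof -
  define X where "X = A \<inter> B"
  have finX: "finite X" using assms by (simp add: X_def)
  have "A = (A - B) \<union> X" "B = (B - A) \<union> X" by (auto simp: X_def)
  then have "char_avg A n = char_avg (A - B) n * char_avg X n"
            "char_avg B n = char_avg (B - A) n * char_avg X n"
    using assms char_avg_union[of "A - B" X n] char_avg_union[of "B - A" X n]
    by (auto simp: X_def)
  then have "char_avg A n * char_avg B n
      = char_avg (A - B) n * char_avg (B - A) n * (char_avg X n)\<^sup>2"
    by (simp add: power2_eq_square)
  also have "(char_avg X n)\<^sup>2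
      = (\<Prod>p\<in>X. (real p - 2) / (real p - 1) * local_char_avg p n + 1 / (real p - 1))"
    unfolding char_avg_def prod_power_distrib
    using assms(3) by (intro prod.cong refl local_char_avg_square) (auto simp: X_def)
  also have "\<dots> = (\<Sum>f\<in>Pow X. (\<Prod>p\<in>f. (real p - 2) / (real p - 1) * local_char_avg p n)
      * (\<Prod>p\<in>X - f. 1 / (real p - 1)))"
    using finX by (rule prod_add)
  also have "\<dots> = (\<Sum>f\<in>Pow X. (\<Prod>p\<in>f. (real p - 2) / (real p - 1)) * (1 / phi (X - f)) * char_avg f n)"
    by (intro sum.cong refl) (simp add: prod.distrib char_avg_def phi_def prod_dividef)
  finally have "char_avg A n * char_avg B n
      = (\<Sum>f\<in>Pow X. (\<Prod>p\<in>f. (real p - 2) / (real p - 1)) * (1 / phi (X - f))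
        * (char_avg (A - B) n * char_avg (B - A) n * char_avg f n))"
    by (simp add: sum_distrib_left mult_ac)
  also have "\<dots> = (\<Sum>f\<in>Pow X. (\<Prod>p\<in>f. (real p - 2) / (real p - 1)) * (1 / phi (X - f))
        * char_avg ((A - B) \<union> (B - A) \<union> f) n)"
  proof (intro sum.cong refl arg_cong2[where f = "(*)"])
    fix f assume "f \<in> Pow X"
    then have f: "f \<subseteq> X" "finite f" using finX finite_subset by auto
    have "char_avg ((A - B) \<union> (B - A)) n = char_avg (A - B) n * char_avg (B - A) n"
      using assms by (intro char_avg_union) auto
    moreover have "char_avg ((A - B) \<union> (B - A) \<union> f) n = char_avg ((A - B) \<union> (B - A)) n * char_avg f n"
      using assms f by (intro char_avg_union) (auto simp: X_def)
    ultimately show "char_avg (A - B) n * char_avg (B - A) n * char_avg f n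
        = char_avg ((A - B) \<union> (B - A) \<union> f) n" by simp
  qed
  finally show ?thesis by (simp add: X_def)
qed

text \<open>
  For \<open>n\<close> prime to \<open>d\<close> one has \<open>c\<^sub>d(n) = \<mu>(d)\<close>, so all terms are positive.
\<close>

lemma selberg_eq_sieve_mass:
  assumes "\<And>p. p \<in> P \<Longrightarrow> \<not> int p dvd n"
  shows "selberg_sum P R n = sieve_mass P R"
proof -
  have "(-1) ^ card A * char_avg A n = 1 / phi A" if "A \<subseteq> P" for A
  proof -
    have "char_avg A n = (\<Prod>p\<in>A. - 1 * (1 / (real p - 1)))"
      unfolding char_avg_def local_char_avg_def using assms that by (intro prod.cong) auto
    also have "\<dots> = (-1) ^ card A * (1 / phi A)"
      unfolding prod.distrib by (simp add: phi_def prod_dividef)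
    finally show ?thesis by (simp flip: power_add)
  qed
  then show ?thesis
    unfolding selberg_sum_def sieve_mass_def by (intro sum.cong) (auto simp: sieve_support_def)
qed

text \<open>
  By \<open>char_avg_mult\<close> each pair \<open>(A, C)\<close> of moduli contributes to the moduli \<open>D\<close> that consist of the
  symmetric difference of \<open>A\<close> and \<open>C\<close> and a set \<open>f\<close> of common primes. If \<open>k\<close> denotes the set of the
  other common primes, then the coefficient is at most \<open>1 / phi k\<close>. For given \<open>D\<close> and \<open>k\<close> the pair is
  determined by the two subsets \<open>A - C\<close> and \<open>f\<close> of \<open>D\<close>, so each \<open>k\<close> occurs at most \<open>4 ^ card D\<close>
  times. As \<open>k\<close> is again in the support of the sieve, the sum over \<open>k\<close> is at most the sieve mass.
  For \<open>D = {}\<close> the factor is one, so the main term is sharp.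
\<close>

lemma sum_selberg_square_le:
  fixes F G :: "int set"
  assumes P: "finite P" "\<And>p. p \<in> P \<Longrightarrow> prime p"
  defines "B \<equiv> (\<lambda>D. \<Sum>x\<in>G. \<Sum>z\<in>F. char_avg D (x - z))"
  shows "(\<Sum>x\<in>G. \<Sum>z\<in>F. (selberg_sum P R (x - z))\<^sup>2)
    \<le> sieve_mass P R * (\<Sum>D\<in>sieve_support P (R\<^sup>2). 4 ^ card D * \<bar>B D\<bar>)"
proof -
  define S where "S = sieve_support P R"
  define S2 where "S2 = sieve_support P (R\<^sup>2)"
  define T where "T = Sigma S (\<lambda>A. Sigma S (\<lambda>B. Pow (A \<inter> B)))"
  define \<Delta> :: "nat set \<Rightarrow> nat set \<Rightarrow> nat set \<Rightarrow> nat set"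
    where "\<Delta> A B f = (A - B) \<union> (B - A) \<union> f" for A B f
  have finS: "finite S" and finS2: "finite S2" unfolding S_def S2_def using P finite_sieve_support by auto
  have SP: "A \<subseteq> P" "finite A" if "A \<in> S" for A
    using that P finite_subset by (auto simp: S_def sieve_support_def)
  have S2P: "A \<subseteq> P" "finite A" if "A \<in> S2" for A
    using that P finite_subset by (auto simp: S2_def sieve_support_def)
  have finT: "finite T" unfolding T_def using finS SP by (intro finite_SigmaI) auto
  have pair: "(\<Sum>x\<in>G. \<Sum>z\<in>F. ((-1) ^ card A * char_avg A (x - z)) * ((-1) ^ card C * char_avg C (x - z)))
      \<le> (\<Sum>f\<in>Pow (A \<inter> C). \<bar>B (\<Delta> A C f)\<bar> / phi (A \<inter> C - f))"
    if AC: "A \<in> S" "C \<in> S" for A C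
  proof -
    define w where "w f = (\<Prod>p\<in>f. (real p - 2) / (real p - 1)) * (1 / phi (A \<inter> C - f))" for f
    define s :: real where "s = (-1) ^ card A * (-1) ^ card C"
    have "(\<Sum>x\<in>G. \<Sum>z\<in>F. ((-1) ^ card A * char_avg A (x - z)) * ((-1) ^ card C * char_avg C (x - z)))
        = (\<Sum>x\<in>G. \<Sum>z\<in>F. s * (char_avg A (x - z) * char_avg C (x - z)))"
      by (simp add: s_def mult_ac)
    also have "\<dots> = (\<Sum>x\<in>G. \<Sum>z\<in>F. \<Sum>f\<in>Pow (A \<inter> C). s * w f * char_avg (\<Delta> A C f) (x - z))"
    proof (intro sum.cong refl)
      fix x z
      have "char_avg A (x - z) * char_avg C (x - z)
          = (\<Sum>f\<in>Pow (A \<inter> C). w f * char_avg (\<Delta> A C f) (x - z))"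
        unfolding w_def \<Delta>_def using SP[OF AC(1)] SP[OF AC(2)] P(2)
        by (intro char_avg_mult) blast+
      then show "s * (char_avg A (x - z) * char_avg C (x - z))
          = (\<Sum>f\<in>Pow (A \<inter> C). s * w f * char_avg (\<Delta> A C f) (x - z))"
        by (simp add: sum_distrib_left mult.assoc)
    qed
    also have "\<dots> = (\<Sum>f\<in>Pow (A \<inter> C). \<Sum>x\<in>G. \<Sum>z\<in>F. s * w f * char_avg (\<Delta> A C f) (x - z))"
      by (subst sum.swap, subst sum.swap[of _ _ G]) (intro sum.cong refl sum.swap)
    also have "\<dots> = (\<Sum>f\<in>Pow (A \<inter> C). s * w f * B (\<Delta> A C f))"
      unfolding B_def by (simp add: sum_distrib_left)
    also have "\<dots> \<le> (\<Sum>f\<in>Pow (A \<inter> C). \<bar>B (\<Delta> A C f)\<bar> / phi (A \<inter> C - f))"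
    proof (intro sum_mono)
      fix f assume f: "f \<in> Pow (A \<inter> C)"
      have prm: "prime p" if "p \<in> A \<inter> C" for p using that SP(1)[OF AC(1)] P(2) by blast
      have ph: "phi (A \<inter> C - f) \<ge> 1" using prm by (intro phi_ge_1) auto
      have "0 \<le> (\<Prod>p\<in>f. (real p - 2) / (real p - 1))" "(\<Prod>p\<in>f. (real p - 2) / (real p - 1)) \<le> 1"
      proof -
        have "0 \<le> (real p - 2) / (real p - 1) \<and> (real p - 2) / (real p - 1) \<le> 1" if "p \<in> f" for p
        proof -
          have "real p \<ge> 2" using prm[of p] f that prime_ge_2_nat by fastforce
          then show ?thesis by (simp add: field_simps)
        qed
        then show "0 \<le> (\<Prod>p\<in>f. (real p - 2) / (real p - 1))" "(\<Prod>p\<in>f. (real p - 2) / (real p - 1)) \<le> 1"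
          by (auto intro!: prod_nonneg prod_le_1)
      qed
      then have "\<bar>w f\<bar> \<le> 1 / phi (A \<inter> C - f)"
        using ph unfolding w_def by (simp add: abs_mult divide_right_mono)
      moreover have "\<bar>s\<bar> = 1" by (simp add: s_def abs_mult power_abs)
      ultimately have "\<bar>s * w f * B (\<Delta> A C f)\<bar> \<le> 1 / phi (A \<inter> C - f) * \<bar>B (\<Delta> A C f)\<bar>"
        unfolding abs_mult by (intro mult_right_mono) auto
      then show "s * w f * B (\<Delta> A C f) \<le> \<bar>B (\<Delta> A C f)\<bar> / phi (A \<inter> C - f)" by simp
    qed
    finally show ?thesis .
  qed
  have "(\<Sum>x\<in>G. \<Sum>z\<in>F. (selberg_sum P R (x - z))\<^sup>2)
      = (\<Sum>x\<in>G. \<Sum>z\<in>F. \<Sum>A\<in>S. \<Sum>C\<in>S.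
          ((-1) ^ card A * char_avg A (x - z)) * ((-1) ^ card C * char_avg C (x - z)))"
    by (simp only: power2_eq_square selberg_sum_def sum_product S_def)
  also have "\<dots> = (\<Sum>A\<in>S. \<Sum>C\<in>S. \<Sum>x\<in>G. \<Sum>z\<in>F.
          ((-1) ^ card A * char_avg A (x - z)) * ((-1) ^ card C * char_avg C (x - z)))"
  proof -
    have swap: "(\<Sum>x\<in>X. \<Sum>A\<in>S. \<Sum>C\<in>S. h x A C) = (\<Sum>A\<in>S. \<Sum>C\<in>S. \<Sum>x\<in>X. h x A C)"
      for h :: "int \<Rightarrow> nat set \<Rightarrow> nat set \<Rightarrow> real" and X
      by (subst sum.swap, intro sum.cong refl, rule sum.swap)
    show ?thesis unfolding swap ..
  qed
  also have "\<dots> \<le> (\<Sum>A\<in>S. \<Sum>C\<in>S. \<Sum>f\<in>Pow (A \<inter> C). \<bar>B (\<Delta> A C f)\<bar> / phi (A \<inter> C - f))"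
    by (intro sum_mono pair)
  also have "\<dots> = (\<Sum>(A, C, f)\<in>T. \<bar>B (\<Delta> A C f)\<bar> / phi (A \<inter> C - f))"
    unfolding T_def using finS SP by (simp add: sum.Sigma)
  also have "\<dots> = (\<Sum>(k, D, U, f)\<in>(\<lambda>(A, C, f). (A \<inter> C - f, \<Delta> A C f, A - C, f)) ` T. \<bar>B D\<bar> / phi k)"
  proof (subst sum.reindex)
    show "inj_on (\<lambda>(A, C, f). (A \<inter> C - f, \<Delta> A C f, A - C, f)) T"
    proof (rule inj_on_inverseI)
      fix t assume "t \<in> T"
      \<comment> \<open>The pair \<open>(A, C)\<close> is recovered from \<open>k\<close>, \<open>D\<close>, \<open>U = A - C\<close> and \<open>f\<close>.\<close>
      then show "(\<lambda>(k, D, U, f). (U \<union> f \<union> k, (D - U) \<union> k, f)) ((\<lambda>(A, C, f). (A \<inter> C - f, \<Delta> A C f, A - C, f)) t) = t"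
        unfolding T_def \<Delta>_def by auto
    qed
  qed (auto intro!: sum.cong)
  also have "\<dots> \<le> (\<Sum>(k, D, U, f)\<in>Sigma S (\<lambda>k. Sigma S2 (\<lambda>D. Pow D \<times> Pow D)). \<bar>B D\<bar> / phi k)"
  proof (intro sum_mono2)
    show "finite (Sigma S (\<lambda>k. Sigma S2 (\<lambda>D. Pow D \<times> Pow D)))"
      using finS finS2 S2P by (intro finite_SigmaI) auto
    have "\<Delta> A C f \<in> S2" if "A \<in> S" "C \<in> S" "f \<subseteq> A \<inter> C" for A C f
    proof -
      have sub: "\<Delta> A C f \<subseteq> A \<union> C" using that by (auto simp: \<Delta>_def)
      have "\<Prod>(A \<union> C) dvd \<Prod>A * \<Prod>C"
      proof -
        have "\<Prod>(A \<union> C) = \<Prod>A * \<Prod>(C - A)"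
          using SP that prod.union_disjoint[of A "C - A" "\<lambda>x. x"] by auto
        moreover have "\<Prod>(C - A) dvd \<Prod>C" using SP that by (intro prod_dvd_prod_subset) auto
        ultimately show ?thesis by (simp add: mult_dvd_mono)
      qed
      moreover have "\<Prod>A * \<Prod>C > 0"
      proof -
        have "\<And>p. p \<in> A \<union> C \<Longrightarrow> 0 < p"
          using SP(1)[OF that(1)] SP(1)[OF that(2)] P(2) prime_gt_0_nat by blast
        then show ?thesis by (auto intro!: prod_pos)
      qed
      ultimately have "\<Prod>(A \<union> C) \<le> \<Prod>A * \<Prod>C" using dvd_imp_le by blast
      also have "\<dots> \<le> R\<^sup>2"
        using that unfolding power2_eq_square S_def sieve_support_def by (auto intro!: mult_mono)
      finally have "A \<union> C \<in> sieve_support P (R\<^sup>2)"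
        using SP that by (auto simp: sieve_support_def)
      then show ?thesis unfolding S2_def using sub P by (rule sieve_support_mono)
    qed
    moreover have "A \<inter> C - f \<in> S" if "A \<in> S" for A C f
      using that P unfolding S_def by (rule_tac sieve_support_mono) auto
    ultimately show "(\<lambda>(A, C, f). (A \<inter> C - f, \<Delta> A C f, A - C, f)) ` T
        \<subseteq> Sigma S (\<lambda>k. Sigma S2 (\<lambda>D. Pow D \<times> Pow D))"
      unfolding T_def by (auto simp: \<Delta>_def)
  next
    fix t assume "t \<in> Sigma S (\<lambda>k. Sigma S2 (\<lambda>D. Pow D \<times> Pow D)) - (\<lambda>(A, C, f). (A \<inter> C - f, \<Delta> A C f, A - C, f)) ` T"
    then have "fst t \<in> S" by auto
    then have "phi (fst t) \<ge> 1" using SP(1)[of "fst t"] P(2) by (intro phi_ge_1) blast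
    then show "0 \<le> (case t of (k, D, U, f) \<Rightarrow> \<bar>B D\<bar> / phi k)" by (auto split: prod.splits)
  qed
  also have "\<dots> = (\<Sum>k\<in>S. \<Sum>D\<in>S2. \<Sum>(U, f)\<in>Pow D \<times> Pow D. \<bar>B D\<bar> / phi k)"
    using finS finS2 S2P by (subst sum.Sigma, simp, simp add: finite_SigmaI, subst sum.Sigma, simp_all add: case_prod_unfold)
  also have "\<dots> = (\<Sum>k\<in>S. \<Sum>D\<in>S2. 4 ^ card D * \<bar>B D\<bar> / phi k)"
  proof (intro sum.cong refl)
    fix k D assume "D \<in> S2"
    then have "real (card (Pow D \<times> Pow D)) = 4 ^ card D"
      using S2P by (simp add: card_cartesian_product card_Pow power_mult_distrib[symmetric])
    then show "(\<Sum>(U, f)\<in>Pow D \<times> Pow D. \<bar>B D\<bar> / phi k) = 4 ^ card D * \<bar>B D\<bar> / phi k"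
      by (simp add: case_prod_unfold)
  qed
  also have "\<dots> = sieve_mass P R * (\<Sum>D\<in>S2. 4 ^ card D * \<bar>B D\<bar>)"
    unfolding sieve_mass_def S_def[symmetric] sum_product by simp
  finally show ?thesis by (simp add: S2_def)
qed

text \<open>
  Each prime \<open>p \<ge> 18\<close> satisfies \<open>4 \<surd>p \<le> p - 1\<close>, and at least one prime exceeding \<open>Q\<close> is present.
\<close>

lemma four_pow_card_le_phi:
  assumes "finite D" "D \<noteq> {}" "\<And>p. p \<in> D \<Longrightarrow> prime p \<and> p > Q" "Q \<ge> 18"
  shows "4 ^ card D \<le> phi D / sqrt (real Q)"
proof -
  have local: "4 * sqrt (real p) \<le> real p - 1" if "p > Q" for p
  proof (rule power2_le_imp_le)
    have "real p \<ge> 18" using that assms(4) by simp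
    then have "real p * (real p - 18) \<ge> 0" by simp
    then show "(4 * sqrt (real p))\<^sup>2 \<le> (real p - 1)\<^sup>2"
      by (simp add: power_mult_distrib) (simp add: power2_eq_square algebra_simps)
    show "0 \<le> real p - 1" using \<open>real p \<ge> 18\<close> by simp
  qed
  obtain q where q: "q \<in> D" using assms(2) by blast
  have "4 ^ card D * sqrt (real Q) \<le> 4 ^ card D * (\<Prod>p\<in>D. sqrt (real p))"
  proof (intro mult_left_mono)
    have "sqrt (real Q) \<le> sqrt (real q)" using assms(3)[OF q] by simp
    also have "\<dots> = sqrt (real q) * 1" by simp
    also have "\<dots> \<le> sqrt (real q) * (\<Prod>p\<in>D - {q}. sqrt (real p))"
      using assms(3,4) by (intro mult_left_mono prod_ge_1) (force simp: Suc_le_eq)+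
    also have "\<dots> = (\<Prod>p\<in>D. sqrt (real p))" using assms(1) q by (simp add: prod.remove)
    finally show "sqrt (real Q) \<le> (\<Prod>p\<in>D. sqrt (real p))" .
  qed simp
  also have "\<dots> = (\<Prod>p\<in>D. 4 * sqrt (real p))" by (simp add: prod.distrib)
  also have "\<dots> \<le> phi D"
    unfolding phi_def using assms(3) local by (intro prod_mono) auto
  finally show ?thesis using assms(4) by (simp add: field_simps)
qed

lemma sieve_mass_ge_1:
  assumes "finite P" "\<And>p. p \<in> P \<Longrightarrow> prime p" "R \<ge> 1"
  shows "sieve_mass P R \<ge> 1"
proof -
  have "(\<Sum>A\<in>{{}}. 1 / phi A) \<le> sieve_mass P R"
    unfolding sieve_mass_def
  proof (intro sum_mono2)
    fix A assume "A \<in> sieve_support P R - {{}}"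
    then have "phi A \<ge> 1" using assms(2) by (intro phi_ge_1) (auto simp: sieve_support_def)
    then show "0 \<le> 1 / phi A" by simp
  qed (use assms finite_sieve_support in \<open>auto simp: sieve_support_def\<close>)
  then show ?thesis by (simp add: phi_def)
qed

text \<open>
  The left-hand side times the sieve mass is at most the sum of the squared Selberg sum over all
  pairs. The modulus one contributes the first term on the right. For the other moduli
  \<open>four_pow_card_le_phi\<close> saves \<open>\<surd>Q\<close> over the bound from the large sieve. The exponent of \<open>R\<close>
  is \<open>8\<close> because products of two elements of the sieve support reach up to \<open>R\<^sup>2\<close>.
\<close>

lemma bilinear_selberg_sieve:
  fixes M :: int and N R Q :: nat
  assumes P: "finite P" "\<And>p. p \<in> P \<Longrightarrow> prime p \<and> p > Q" and Q: "Q \<ge> 18" and R: "R \<ge> 1"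
    and F: "F \<subseteq> {M..<M + int N}" and G: "G \<subseteq> {M..<M + int N}"
  shows "sieve_mass P R * real (card {(x, z) \<in> G \<times> F. \<forall>p\<in>P. \<not> int p dvd x - z})
    \<le> real (card F) * real (card G)
      + (real N + real R ^ 8) / sqrt (real Q) * sqrt (real (card F) * real (card G))"
proof -
  define B where "B D = (\<Sum>x\<in>G. \<Sum>z\<in>F. char_avg D (x - z))" for D
  define S2 where "S2 = sieve_support P (R\<^sup>2)"
  define m where "m = sieve_mass P R"
  define X where "X = {(x, z) \<in> G \<times> F. \<forall>p\<in>P. \<not> int p dvd x - z}"
  have finFG: "finite F" "finite G" using F G finite_subset by blast+
  have prm: "\<And>p. p \<in> P \<Longrightarrow> prime p" using P by blast
  have m: "m \<ge> 1" unfolding m_def using P R by (intro sieve_mass_ge_1) auto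
  have "m\<^sup>2 * real (card X) = (\<Sum>(x, z)\<in>X. (selberg_sum P R (x - z))\<^sup>2)"
    unfolding X_def m_def by (simp add: case_prod_unfold selberg_eq_sieve_mass)
  also have "\<dots> \<le> (\<Sum>(x, z)\<in>G \<times> F. (selberg_sum P R (x - z))\<^sup>2)"
    using finFG by (intro sum_mono2) (auto simp: X_def)
  also have "\<dots> = (\<Sum>x\<in>G. \<Sum>z\<in>F. (selberg_sum P R (x - z))\<^sup>2)"
    by (simp add: sum.cartesian_product)
  also have "\<dots> \<le> m * (\<Sum>D\<in>S2. 4 ^ card D * \<bar>B D\<bar>)"
    unfolding m_def S2_def B_def using P(1) prm by (rule sum_selberg_square_le)
  finally have "m * real (card X) \<le> (\<Sum>D\<in>S2. 4 ^ card D * \<bar>B D\<bar>)"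
    using m by (simp add: power2_eq_square mult.assoc)
  also have "\<dots> = \<bar>B {}\<bar> + (\<Sum>D\<in>S2 - {{}}. 4 ^ card D * \<bar>B D\<bar>)"
  proof -
    have "finite S2" "{} \<in> S2" using P(1) R by (auto simp: S2_def finite_sieve_support sieve_support_def)
    then show ?thesis by (simp add: sum.remove)
  qed
  also have "\<bar>B {}\<bar> = real (card F) * real (card G)" by (simp add: B_def char_avg_def)
  also have "(\<Sum>D\<in>S2 - {{}}. 4 ^ card D * \<bar>B D\<bar>) \<le> (\<Sum>D\<in>S2 - {{}}. phi D / sqrt (real Q) * \<bar>B D\<bar>)"
    using P Q finite_subset[OF _ P(1)]
    by (intro sum_mono mult_right_mono four_pow_card_le_phi) (auto simp: S2_def sieve_support_def)
  also have "\<dots> = (\<Sum>D\<in>S2 - {{}}. phi D * \<bar>B D\<bar>) / sqrt (real Q)"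
    by (simp add: sum_divide_distrib)
  also have "\<dots> \<le> ((real N + real (R\<^sup>2) ^ 4) * sqrt (real (card F) * real (card G))) / sqrt (real Q)"
    unfolding B_def using P finite_sieve_support[OF P(1), of "R\<^sup>2"] finite_subset[OF _ P(1)] F G
    by (intro divide_right_mono sum_phi_char_avg_bilinear_le) (auto simp: S2_def sieve_support_def)
  also have "real (R\<^sup>2) ^ 4 = real R ^ 8" by (simp flip: power_mult)
  finally show ?thesis by (simp add: m_def X_def)
qed

section \<open>The sieve mass\<close>

abbreviation primes_upto :: "nat \<Rightarrow> nat set" where
  "primes_upto n \<equiv> {p. prime p \<and> p \<le> n}"

lemma finite_primes_upto: "finite (primes_upto n)"
  by (rule finite_subset[of _ "{..n}"]) auto

lemma harm_le_one_plus_ln: "n \<ge> 1 \<Longrightarrow> harm n \<le> 1 + ln (real n)"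
proof (induction n rule: dec_induct)
  case base
  then show ?case by (simp add: harm_expand)
next
  case (step n)
  have "ln (real n / real (Suc n)) \<le> real n / real (Suc n) - 1"
    using step by (intro ln_le_minus_one) auto
  then have "inverse (real (Suc n)) \<le> ln (real (Suc n)) - ln (real n)"
    using step by (simp add: ln_div field_simps)
  then show ?case using step by (simp add: harm_Suc)
qed

text \<open>
  Compare \<open>\<Sum>\<^bsub>k\<le>n\<^esub> \<Sum>\<^bsub>p dvd k\<^esub> log p \<le> \<Sum>\<^bsub>k\<le>n\<^esub> log k \<le> n log n\<close> with the fact that at least \<open>n / (2 p)\<close> of
  the numbers up to \<open>n\<close> are multiples of \<open>p\<close>.
\<close>

lemma sum_ln_over_primes_le:
  assumes "n \<ge> 1"
  shows "(\<Sum>p\<in>primes_upto n. ln (real p) / real p) \<le> 2 * ln (real n)"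
proof -
  have half: "real n / (2 * real p) \<le> real (card {k\<in>{1..n}. p dvd k})"
    if p: "p \<in> primes_upto n" for p
  proof -
    have p0: "p > 0" using p prime_gt_0_nat by blast
    have "(\<lambda>j. p * j) ` {1..n div p} \<subseteq> {k\<in>{1..n}. p dvd k}"
    proof
      fix k assume "k \<in> (\<lambda>j. p * j) ` {1..n div p}"
      then obtain j where j: "k = p * j" "1 \<le> j" "j \<le> n div p" by (auto simp only: image_iff atLeastAtMost_iff)
      have "p * j \<le> p * (n div p)" using j by simp
      also have "\<dots> \<le> n" by simp
      finally show "k \<in> {k\<in>{1..n}. p dvd k}" using j p0 by simp
    qed
    moreover have "inj_on (\<lambda>j. p * j) {1..n div p}" using p0 by (auto simp: inj_on_def)
    ultimately have "n div p \<le> card {k\<in>{1..n}. p dvd k}"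
      using card_inj_on_le[of "\<lambda>j. p * j" "{1..n div p}" "{k\<in>{1..n}. p dvd k}"] by simp
    moreover have "n \<le> 2 * p * (n div p)"
    proof -
      have "n div p \<ge> 1" using p p0 by (simp add: Suc_le_eq div_greater_zero_iff)
      then have "p \<le> p * (n div p)" by simp
      moreover have "n mod p < p" using p0 by simp
      moreover have "n = p * (n div p) + n mod p" by simp
      ultimately show ?thesis by linarith
    qed
    then have "real n \<le> real (2 * p * (n div p))" by (simp only: of_nat_le_iff)
    then have "real n / (2 * real p) \<le> real (n div p)"
      using p0 by (simp add: field_simps)
    ultimately show ?thesis by linarith
  qed
  have "real n / 2 * (\<Sum>p\<in>primes_upto n. ln (real p) / real p)
      = (\<Sum>p\<in>primes_upto n. ln (real p) * (real n / (2 * real p)))"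
    by (simp add: sum_distrib_left mult_ac)
  also have "\<dots> \<le> (\<Sum>p\<in>primes_upto n. ln (real p) * real (card {k\<in>{1..n}. p dvd k}))"
    using prime_ge_1_nat by (intro sum_mono mult_left_mono half) (auto simp: Suc_le_eq prime_gt_0_nat)
  also have "\<dots> = (\<Sum>p\<in>primes_upto n. \<Sum>k\<in>{1..n}. if p dvd k then ln (real p) else 0)"
    by (intro sum.cong refl) (simp add: sum.If_cases Int_def mult.commute)
  also have "\<dots> = (\<Sum>k\<in>{1..n}. \<Sum>p\<in>primes_upto n. if p dvd k then ln (real p) else 0)"
    by (rule sum.swap)
  also have "\<dots> \<le> (\<Sum>k\<in>{1..n}. ln (real n))"
  proof (intro sum_mono)
    fix k assume k: "k \<in> {1..n}"
    have "(\<Sum>p\<in>primes_upto n. if p dvd k then ln (real p) else 0)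
        = (\<Sum>p\<in>primes_upto n \<inter> {p. p dvd k}. mangoldt p)"
      using finite_primes_upto[of n] by (subst sum.If_cases) auto
    also have "\<dots> \<le> (\<Sum>d | d dvd k. mangoldt d)"
      using k by (intro sum_mono2) (auto simp: mangoldt_nonneg)
    also have "\<dots> = ln (real k)" using k mangoldt_sum[of k, where ?'a = real] by simp
    also have "\<dots> \<le> ln (real n)" using k by simp
    finally show "(\<Sum>p\<in>primes_upto n. if p dvd k then ln (real p) else 0) \<le> ln (real n)" .
  qed
  also have "\<dots> = real n / 2 * (2 * ln (real n))" by simp
  finally show ?thesis using assms by simp
qed

lemma sum_inverse_prod_prime_sets_le_harm:
  assumes "finite \<D>" "\<And>D. D \<in> \<D> \<Longrightarrow> finite D \<and> (\<forall>p\<in>D. prime p) \<and> \<Prod>D \<le> (K::nat)"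
  shows "(\<Sum>D\<in>\<D>. 1 / real (\<Prod>D)) \<le> harm K"
proof -
  have inj: "inj_on (\<lambda>D. \<Prod>D) \<D>"
    using assms(2) by (intro inj_onI prime_sets_eq_if_prod_eq) auto
  have "(\<Sum>D\<in>\<D>. 1 / real (\<Prod>D)) = (\<Sum>m\<in>(\<lambda>D. \<Prod>D) ` \<D>. 1 / real m)"
    using inj by (simp add: sum.reindex)
  also have "\<dots> \<le> (\<Sum>m\<in>{1..K}. 1 / real m)"
  proof (intro sum_mono2)
    show "(\<lambda>D. \<Prod>D) ` \<D> \<subseteq> {1..K}"
      using assms(2) by (force simp: Suc_le_eq intro!: prod_pos prime_gt_0_nat)
  qed auto
  finally show ?thesis by (simp add: harm_def inverse_eq_divide)
qed

text \<open>
  An upper bound for the Mertens product: the left-hand side is \<open>V = \<Prod>\<^bsub>p\<le>n\<^esub> (1 + 1 / p)\<close>, multiplied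
  out over squarefree numbers. Those up to \<open>n ^ 4\<close> contribute at most a harmonic sum. For the others
  the factor \<open>log (\<Prod>A) / (4 log n)\<close> is at least one, and the sum of \<open>log (\<Prod>A) / \<Prod>A\<close> is
  at most \<open>V\<close> times \<open>\<Sum>\<^bsub>p\<le>n\<^esub> log p / p \<le> 2 log n\<close>. So they contribute at most \<open>V / 2\<close>,
  which is absorbed into the left-hand side.
\<close>

lemma sum_inverse_prod_primes_upto_le:
  assumes n: "n \<ge> 2"
  shows "(\<Sum>A\<in>Pow (primes_upto n). 1 / real (\<Prod>A)) \<le> 2 + 8 * ln (real n)"
proof -
  define S where "S = Pow (primes_upto n)"
  define V where "V = (\<Sum>A\<in>S. 1 / real (\<Prod>A))"
  define L where "L = ln (real n)"
  have L: "L > 0" using n by (simp add: L_def)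
  have finS: "finite S" by (simp add: S_def finite_primes_upto)
  have SP: "finite A" "\<And>p. p \<in> A \<Longrightarrow> prime p" "\<Prod>A > 0" if "A \<in> S" for A
    using that finite_subset[OF _ finite_primes_upto[of n]] prime_gt_0_nat
    by (auto simp: S_def intro!: prod_pos)
  \<comment> \<open>The second summand dominates \<open>1 / \<Prod>A\<close> as soon as \<open>\<Prod>A > n ^ 4\<close>.\<close>
  have "V \<le> (\<Sum>A\<in>S. (if \<Prod>A \<le> n ^ 4 then 1 / real (\<Prod>A) else 0) + ln (real (\<Prod>A)) / (4 * L) / real (\<Prod>A))"
    unfolding V_def
  proof (intro sum_mono)
    fix A assume A: "A \<in> S"
    have pos: "real (\<Prod>A) \<ge> 1" using SP(3)[OF A] by linarith
    show "1 / real (\<Prod>A) \<le> (if \<Prod>A \<le> n ^ 4 then 1 / real (\<Prod>A) else 0) + ln (real (\<Prod>A)) / (4 * L) / real (\<Prod>A)"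
    proof (cases "\<Prod>A \<le> n ^ 4")
      case True
      then show ?thesis using pos L by simp
    next
      case False
      then have "real n ^ 4 \<le> real (\<Prod>A)" by (metis nat_le_linear of_nat_le_iff of_nat_power)
      then have "ln (real n ^ 4) \<le> ln (real (\<Prod>A))" using n by (intro ln_mono) auto
      then have "1 \<le> ln (real (\<Prod>A)) / (4 * L)" using L n by (simp add: L_def ln_realpow)
      then have "1 / real (\<Prod>A) \<le> ln (real (\<Prod>A)) / (4 * L) / real (\<Prod>A)"
        using pos by (intro divide_right_mono) auto
      then show ?thesis using False by simp
    qed
  qed
  also have "\<dots> = (\<Sum>A\<in>{A\<in>S. \<Prod>A \<le> n ^ 4}. 1 / real (\<Prod>A))
      + (\<Sum>A\<in>S. ln (real (\<Prod>A)) / real (\<Prod>A)) / (4 * L)"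
    using finS by (simp add: sum.distrib sum.If_cases Int_def sum_divide_distrib mult.commute)
  also have "(\<Sum>A\<in>{A\<in>S. \<Prod>A \<le> n ^ 4}. 1 / real (\<Prod>A)) \<le> harm (n ^ 4)"
    using finS SP by (intro sum_inverse_prod_prime_sets_le_harm) auto
  also have "harm (n ^ 4) \<le> 1 + ln (real (n ^ 4))" using n by (intro harm_le_one_plus_ln) simp
  also have "\<dots> = 1 + 4 * L" using n by (simp add: L_def ln_realpow)
  also have "(\<Sum>A\<in>S. ln (real (\<Prod>A)) / real (\<Prod>A)) \<le> V * (2 * L)"
  proof -
    have "(\<Sum>A\<in>S. ln (real (\<Prod>A)) / real (\<Prod>A))
        = (\<Sum>A\<in>S. \<Sum>p\<in>primes_upto n. if p \<in> A then ln (real p) / real (\<Prod>A) else 0)"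
    proof (intro sum.cong refl)
      fix A assume A: "A \<in> S"
      have "ln (real (\<Prod>A)) = (\<Sum>p\<in>A. ln (real p))"
        using SP[OF A] prime_gt_0_nat by (simp add: ln_prod)
      moreover have "primes_upto n \<inter> {p. p \<in> A} = A" using A by (auto simp: S_def)
      ultimately show "ln (real (\<Prod>A)) / real (\<Prod>A)
          = (\<Sum>p\<in>primes_upto n. if p \<in> A then ln (real p) / real (\<Prod>A) else 0)"
        using finite_primes_upto[of n] by (simp add: sum.If_cases sum_divide_distrib del: of_nat_prod)
    qed
    also have "\<dots> = (\<Sum>p\<in>primes_upto n. \<Sum>A\<in>S. if p \<in> A then ln (real p) / real (\<Prod>A) else 0)"
      by (rule sum.swap)
    also have "\<dots> \<le> (\<Sum>p\<in>primes_upto n. ln (real p) / real p * V)"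
    proof (intro sum_mono)
      fix p assume p: "p \<in> primes_upto n"
      have p0: "p > 0" using p prime_gt_0_nat by blast
      have "(\<Sum>A\<in>S. if p \<in> A then ln (real p) / real (\<Prod>A) else 0)
          = (\<Sum>A\<in>{A\<in>S. p \<in> A}. ln (real p) / real p * (1 / real (\<Prod>(A - {p}))))"
      proof -
        have "(\<Sum>A\<in>S. if p \<in> A then ln (real p) / real (\<Prod>A) else 0)
            = (\<Sum>A\<in>{A\<in>S. p \<in> A}. ln (real p) / real (\<Prod>A))"
          using finS by (simp add: sum.If_cases Int_def)
        also have "\<dots> = (\<Sum>A\<in>{A\<in>S. p \<in> A}. ln (real p) / real p * (1 / real (\<Prod>(A - {p}))))"
        proof (intro sum.cong refl)
          fix A assume "A \<in> {A\<in>S. p \<in> A}"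
          then have "\<Prod>A = p * \<Prod>(A - {p})" using SP(1)[of A] prod.remove[of A p "\<lambda>x. x"] by simp
          then show "ln (real p) / real (\<Prod>A) = ln (real p) / real p * (1 / real (\<Prod>(A - {p})))"
            by simp
        qed
        finally show ?thesis .
      qed
      also have "\<dots> = (\<Sum>A\<in>(\<lambda>A. A - {p}) ` {A\<in>S. p \<in> A}. ln (real p) / real p * (1 / real (\<Prod>A)))"
        by (subst sum.reindex) (auto simp: inj_on_def)
      also have "\<dots> \<le> (\<Sum>A\<in>S. ln (real p) / real p * (1 / real (\<Prod>A)))"
        using finS p0 by (intro sum_mono2) (auto simp: S_def prod_nonneg)
      also have "\<dots> = ln (real p) / real p * V" by (simp add: V_def sum_distrib_left)
      finally show "(\<Sum>A\<in>S. if p \<in> A then ln (real p) / real (\<Prod>A) else 0) \<le> ln (real p) / real p * V" .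
    qed
    also have "\<dots> = (\<Sum>p\<in>primes_upto n. ln (real p) / real p) * V" by (simp add: sum_distrib_right)
    also have "\<dots> \<le> (2 * L) * V"
      using sum_ln_over_primes_le[of n] n by (intro mult_right_mono) (auto simp: L_def V_def intro!: sum_nonneg prod_nonneg)
    finally show ?thesis by (simp add: mult_ac)
  qed
  finally have "V \<le> 1 + 4 * L + V * (2 * L) / (4 * L)"
    using L by (simp add: divide_right_mono)
  then show ?thesis using L by (simp add: V_def S_def L_def)
qed

lemma sum_inverse_squares_le: "n \<ge> 1 \<Longrightarrow> (\<Sum>m\<in>{1..n}. 1 / (real m)\<^sup>2) \<le> 2 - 1 / real n"
proof (induction n rule: dec_induct)
  case (step n)
  have "real n > 0" using step by simp
  then have "1 / (real (Suc n))\<^sup>2 \<le> 1 / real n - 1 / real (Suc n)"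
    by (simp add: divide_simps) (simp add: power2_eq_square algebra_simps)
  then show ?case using step by simp
qed simp

lemma prod_prime_factors_squarefree:
  fixes n :: nat
  assumes "squarefree n"
  shows "\<Prod>(prime_factors n) = n"
proof -
  have n0: "n \<noteq> 0" using assms by (metis not_squarefree_0)
  then have "(\<Prod>p\<in>prime_factors n. p ^ multiplicity p n) = n"
    by (simp add: prod_prime_factors)
  moreover have "(\<Prod>p\<in>prime_factors n. p ^ multiplicity p n) = \<Prod>(prime_factors n)"
    using assms n0 by (intro prod.cong refl) (simp add: squarefree_factorial_semiring')
  ultimately show ?thesis by simp
qed

text \<open>
  Every \<open>k\<close> is uniquely a squarefree number times a square, and \<open>\<Sum> 1 / m\<^sup>2 \<le> 2\<close>.
\<close>

lemma harm_le_two_mult_squarefree_sum: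
  "harm n \<le> 2 * (\<Sum>A\<in>sieve_support (primes_upto n) n. 1 / real (\<Prod>A))"
proof (cases "n \<ge> 1")
  case True
  define S where "S = sieve_support (primes_upto n) n"
  define \<phi> :: "nat \<Rightarrow> nat \<times> nat set"
    where "\<phi> k = (square_part k, prime_factors (squarefree_part k))" for k
  have k_eq: "k = \<Prod>(snd (\<phi> k)) * fst (\<phi> k) ^ 2" for k
    using squarefree_decompose[of k] prod_prime_factors_squarefree[of "squarefree_part k"]
    by (simp add: \<phi>_def)
  have inj: "inj_on \<phi> {1..n}" by (rule inj_onI) (metis k_eq)
  have finS: "finite S" unfolding S_def using finite_primes_upto by (rule finite_sieve_support)
  have sub: "\<phi> ` {1..n} \<subseteq> {1..n} \<times> S"
  proof
    fix t assume "t \<in> \<phi> ` {1..n}"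
    then obtain k where k: "t = \<phi> k" "1 \<le> k" "k \<le> n" by auto
    obtain m A where mA: "\<phi> k = (m, A)" by fastforce
    have k2: "k = \<Prod>A * m ^ 2" using k_eq[of k] mA by simp
    have m0: "m \<noteq> 0" and A0: "\<Prod>A \<noteq> 0"
      using k2 k(2) by (metis mult_zero_left mult_zero_right not_one_le_zero zero_power2)+
    have "m \<le> m ^ 2" by (simp add: power2_eq_square)
    also have "\<dots> \<le> k" using k2 A0 by simp
    finally have "m \<le> n" using k by simp
    have "\<Prod>A \<le> k" using k2 m0 by simp
    then have "\<Prod>A \<le> n" using k by simp
    have fin: "finite A" and prm: "\<And>p. p \<in> A \<Longrightarrow> prime p"
      using mA by (auto simp: \<phi>_def)
    have "p \<le> n" if "p \<in> A" for p
    proof -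
      have "p dvd \<Prod>A" using fin that by (rule dvd_prodI)
      then have "p \<le> \<Prod>A" using A0 by (intro dvd_imp_le) auto
      then show ?thesis using \<open>\<Prod>A \<le> n\<close> by simp
    qed
    then show "t \<in> {1..n} \<times> S"
      using k mA m0 \<open>m \<le> n\<close> \<open>\<Prod>A \<le> n\<close> prm by (auto simp: S_def sieve_support_def)
  qed
  have "harm n = (\<Sum>k\<in>{1..n}. 1 / real (\<Prod>(snd (\<phi> k)) * fst (\<phi> k) ^ 2))"
    unfolding k_eq[symmetric] by (simp add: harm_def inverse_eq_divide)
  also have "\<dots> = (\<Sum>(m, A)\<in>\<phi> ` {1..n}. 1 / (real m)\<^sup>2 * (1 / real (\<Prod>A)))"
    using inj by (simp add: sum.reindex case_prod_unfold mult.commute)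
  also have "\<dots> \<le> (\<Sum>(m, A)\<in>{1..n} \<times> S. 1 / (real m)\<^sup>2 * (1 / real (\<Prod>A)))"
    using sub finS by (intro sum_mono2) (auto simp: prod_nonneg)
  also have "\<dots> = (\<Sum>m\<in>{1..n}. 1 / (real m)\<^sup>2) * (\<Sum>A\<in>S. 1 / real (\<Prod>A))"
    by (simp add: sum_product sum.cartesian_product)
  also have "\<dots> \<le> 2 * (\<Sum>A\<in>S. 1 / real (\<Prod>A))"
  proof (intro mult_right_mono)
    have "2 - 1 / real n \<le> 2" by simp
    then show "(\<Sum>m\<in>{1..n}. 1 / (real m)\<^sup>2) \<le> 2"
      using sum_inverse_squares_le[OF True] by linarith
  qed (simp add: sum_nonneg prod_nonneg)
  finally show ?thesis by (simp add: S_def)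
next
  case False
  have "0 \<le> (\<Sum>A\<in>sieve_support (primes_upto n) n. 1 / real (\<Prod>A))"
    by (intro sum_nonneg) (simp del: of_nat_prod)
  moreover have "n = 0" using False by simp
  ultimately show ?thesis by (simp add: harm_expand)
qed

text \<open>
  A squarefree number up to \<open>R\<close> is the product of its part composed of primes up to \<open>Q\<close> and its part
  composed of primes in \<open>(Q, R]\<close>. So the harmonic sum is bounded by the Mertens product up to \<open>Q\<close>
  times the sieve mass.
\<close>

lemma sieve_mass_lower_bound:
  assumes Q: "Q \<ge> 2"
  shows "ln (real R + 1) \<le> (4 + 16 * ln (real Q)) * sieve_mass {p. prime p \<and> Q < p \<and> p \<le> R} R"
proof -
  define P where "P = {p. prime p \<and> Q < p \<and> p \<le> R}"
  define S where "S = sieve_support (primes_upto R) R"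
  have finP: "finite P" unfolding P_def by (rule finite_subset[of _ "{..R}"]) auto
  have finS: "finite S" unfolding S_def using finite_primes_upto by (rule finite_sieve_support)
  define split where "split A = (A \<inter> {..Q}, A \<inter> {Q<..})" for A :: "nat set"
  have un: "fst (split A) \<union> snd (split A) = A" "fst (split A) \<inter> snd (split A) = {}" for A
    by (auto simp: split_def)
  have inj: "inj_on split S" by (rule inj_onI) (metis un(1))
  have SA: "finite A" "\<And>p. p \<in> A \<Longrightarrow> prime p" if "A \<in> S" for A
    using that finite_subset[OF _ finite_primes_upto[of R]] by (auto simp: S_def sieve_support_def)
  have mult: "1 / real (\<Prod>A) = 1 / real (\<Prod>(fst (split A))) * (1 / real (\<Prod>(snd (split A))))"
    if "A \<in> S" for A
  proof -
    have "\<Prod>A = \<Prod>(fst (split A)) * \<Prod>(snd (split A))"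
      using SA[OF that] un[of A]
      by (subst prod.union_disjoint[symmetric]) (auto simp: split_def)
    then show ?thesis by simp
  qed
  have sub: "split ` S \<subseteq> Pow (primes_upto Q) \<times> sieve_support P R"
  proof
    fix t assume "t \<in> split ` S"
    then obtain A where A: "A \<in> S" "t = split A" by blast
    have "A \<inter> {Q<..} \<in> S"
      using A(1) finite_primes_upto unfolding S_def by (rule_tac sieve_support_mono) auto
    then show "t \<in> Pow (primes_upto Q) \<times> sieve_support P R"
      using A by (simp add: split_def P_def S_def sieve_support_def subset_iff)
  qed
  have "ln (real R + 1) \<le> harm R" by (rule ln_le_harm)
  also have "\<dots> \<le> 2 * (\<Sum>A\<in>S. 1 / real (\<Prod>A))"
    unfolding S_def by (rule harm_le_two_mult_squarefree_sum)
  also have "(\<Sum>A\<in>S. 1 / real (\<Prod>A)) = (\<Sum>(U, V)\<in>split ` S. 1 / real (\<Prod>U) * (1 / real (\<Prod>V)))"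
    using inj mult by (simp add: sum.reindex case_prod_unfold)
  also have "\<dots> \<le> (\<Sum>(U, V)\<in>Pow (primes_upto Q) \<times> sieve_support P R. 1 / real (\<Prod>U) * (1 / real (\<Prod>V)))"
    using sub finite_primes_upto finite_sieve_support[OF finP] by (intro sum_mono2) (auto simp: prod_nonneg)
  also have "\<dots> = (\<Sum>U\<in>Pow (primes_upto Q). 1 / real (\<Prod>U)) * (\<Sum>V\<in>sieve_support P R. 1 / real (\<Prod>V))"
    by (simp add: sum_product sum.cartesian_product)
  also have "\<dots> \<le> (2 + 8 * ln (real Q)) * sieve_mass P R"
  proof (intro mult_mono)
    show "(\<Sum>U\<in>Pow (primes_upto Q). 1 / real (\<Prod>U)) \<le> 2 + 8 * ln (real Q)"
      using Q by (rule sum_inverse_prod_primes_upto_le)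
    show "(\<Sum>V\<in>sieve_support P R. 1 / real (\<Prod>V)) \<le> sieve_mass P R"
      unfolding sieve_mass_def
    proof (intro sum_mono)
      fix V assume "V \<in> sieve_support P R"
      then have prm: "prime p" if "p \<in> V" for p using that by (auto simp: sieve_support_def P_def)
      have "phi V \<le> (\<Prod>p\<in>V. real p)"
        unfolding phi_def using prm prime_ge_1_nat by (intro prod_mono) force
      moreover have "phi V \<ge> 1" using prm by (rule phi_ge_1)
      ultimately show "1 / real (\<Prod>V) \<le> 1 / phi V" by (simp add: frac_le)
    qed
  qed (use Q in \<open>auto simp: sum_nonneg prod_nonneg\<close>)
  finally show ?thesis by (simp add: P_def algebra_simps)
qed

section \<open>Pairs weighted by the von Mangoldt function\<close>

text \<open>
  The summation range of the average is built into the weight, so that the average over \<open>n\<close> becomes an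
  unrestricted sum over pairs.
\<close>

definition mangoldt_int :: "nat \<Rightarrow> int \<Rightarrow> real" where
  "mangoldt_int N n = (if 1 \<le> n \<and> n \<le> int N then mangoldt (nat n) else 0)"

lemma mangoldt_int_le_ln: "N \<ge> 1 \<Longrightarrow> mangoldt_int N n \<le> ln (real N)"
proof -
  assume N: "N \<ge> 1"
  show ?thesis
  proof (cases "1 \<le> n \<and> n \<le> int N")
    case True
    then have "mangoldt (nat n) \<le> ln (real (nat n))" by (intro mangoldt_le) simp
    also have "\<dots> \<le> ln (real N)" using True by (intro ln_mono) auto
    finally show ?thesis using True by (simp add: mangoldt_int_def)
  qed (use N in \<open>auto simp: mangoldt_int_def\<close>)
qed

text \<open>
  Such an \<open>n\<close> is \<open>p ^ k\<close> with \<open>p \<le> R\<close>, and \<open>2 ^ k \<le> N\<close> forces \<open>k \<le> 2 log N\<close>.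
\<close>

lemma card_primepow_small_base_le:
  assumes N: "N \<ge> 1"
  shows "real (card {n\<in>{1..N}. primepow n \<and> (\<exists>p. prime p \<and> p \<le> R \<and> p dvd n)})
    \<le> real R * (2 * ln (real N))"
proof -
  define K where "K = nat \<lfloor>2 * ln (real N)\<rfloor>"
  have "{n\<in>{1..N}. primepow n \<and> (\<exists>p. prime p \<and> p \<le> R \<and> p dvd n)} \<subseteq> (\<lambda>(p, k). p ^ k) ` ({1..R} \<times> {1..K})"
  proof
    fix n assume "n \<in> {n\<in>{1..N}. primepow n \<and> (\<exists>p. prime p \<and> p \<le> R \<and> p dvd n)}"
    then obtain p where n: "n \<le> N" "primepow n" and p: "prime p" "p \<le> R" "p dvd n" by auto
    obtain q k where q: "prime q" "k > 0" "n = q ^ k" using n(2) by (auto simp: primepow_def)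
    have "p dvd q" using p(1,3) q(3) prime_dvd_power by blast
    then have "p = q" using p(1) q(1) by (rule_tac primes_dvd_imp_eq)
    have "2 ^ k \<le> q ^ k" using prime_ge_2_nat[OF q(1)] by (intro power_mono) auto
    then have "2 ^ k \<le> N" using q(3) n(1) by simp
    then have "real (2 ^ k) \<le> real N" by (simp only: of_nat_le_iff)
    then have "ln (2 ^ k) \<le> ln (real N)" by (intro ln_mono) auto
    then have "real k * ln 2 \<le> ln (real N)" by (simp add: ln_realpow)
    moreover have "real k * (1 / 2) \<le> real k * ln 2"
      using ln2_ge_two_thirds by (intro mult_left_mono) auto
    ultimately have "real k \<le> 2 * ln (real N)" by simp
    then have "k \<le> K" unfolding K_def by (simp add: le_nat_floor)
    then show "n \<in> (\<lambda>(p, k). p ^ k) ` ({1..R} \<times> {1..K})"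
      using q p \<open>p = q\<close> prime_ge_1_nat[OF p(1)] by (intro image_eqI[of _ _ "(q, k)"]) auto
  qed
  then have "card {n\<in>{1..N}. primepow n \<and> (\<exists>p. prime p \<and> p \<le> R \<and> p dvd n)} \<le> card ({1..R} \<times> {1..K})"
    by (intro surj_card_le) auto
  then have "card {n\<in>{1..N}. primepow n \<and> (\<exists>p. prime p \<and> p \<le> R \<and> p dvd n)} \<le> R * K" by simp
  then have "real (card {n\<in>{1..N}. primepow n \<and> (\<exists>p. prime p \<and> p \<le> R \<and> p dvd n)}) \<le> real (R * K)"
    by (simp only: of_nat_le_iff)
  also have "\<dots> \<le> real R * (2 * ln (real N))"
    unfolding of_nat_mult using N by (intro mult_left_mono) (auto simp: K_def)
  finally show ?thesis .
qed

text \<open>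
  If \<open>\<Lambda>(x - z) \<noteq> 0\<close>, then \<open>x - z\<close> is either not divisible by any prime of \<open>P\<close> or a power of a prime of
  \<open>P\<close>. The few powers are counted trivially.
\<close>

lemma sum_mangoldt_int_le_card_sifted:
  assumes fin: "finite F" "finite G" and N: "N \<ge> 1"
    and P: "\<And>p. p \<in> P \<Longrightarrow> prime p \<and> p \<le> R"
  shows "(\<Sum>x\<in>G. \<Sum>z\<in>F. mangoldt_int N (x - z))
    \<le> ln (real N) * (real (card {(x, z) \<in> G \<times> F. \<forall>p\<in>P. \<not> int p dvd x - z})
        + real (card F) * (real R * (2 * ln (real N))))"
proof -
  define X where "X = {(x, z) \<in> G \<times> F. \<forall>p\<in>P. \<not> int p dvd x - z}"
  define E where "E = {n\<in>{1..N}. primepow n \<and> (\<exists>p. prime p \<and> p \<le> R \<and> p dvd n)}"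
  define Y where "Y = {(x, z) \<in> G \<times> F. x - z \<in> int ` E}"
  have L: "ln (real N) \<ge> 0" using N by simp
  have finXY: "finite X" "finite Y" unfolding X_def Y_def using fin by (auto intro: finite_subset[of _ "G \<times> F"])
  have finE: "finite E" by (simp add: E_def)
  have "(\<Sum>x\<in>G. \<Sum>z\<in>F. mangoldt_int N (x - z)) = (\<Sum>(x, z)\<in>G \<times> F. mangoldt_int N (x - z))"
    by (simp add: sum.cartesian_product)
  also have "\<dots> = (\<Sum>(x, z)\<in>X \<union> Y. mangoldt_int N (x - z))"
  proof (intro sum.mono_neutral_right ballI)
    fix t assume t: "t \<in> G \<times> F - (X \<union> Y)"
    obtain x z where xz: "t = (x, z)" by fastforce
    have "mangoldt_int N (x - z) = 0"
    proof (cases "1 \<le> x - z \<and> x - z \<le> int N \<and> primepow (nat (x - z))")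
      case True
      obtain p where p: "p \<in> P" "int p dvd x - z" using t xz by (auto simp: X_def)
      then have "p dvd nat (x - z)" using True by (simp add: nat_dvd_iff dvd_nat_abs_iff int_dvd_int_iff[symmetric] del: int_dvd_int_iff)
      then have "nat (x - z) \<in> E" using True P[OF p(1)] by (auto simp: E_def)
      then have "x - z \<in> int ` E" using True by (intro image_eqI[of _ _ "nat (x - z)"]) auto
      then show ?thesis using t xz by (auto simp: Y_def)
    qed (auto simp: mangoldt_int_def mangoldt_def)
    then show "(case t of (x, z) \<Rightarrow> mangoldt_int N (x - z)) = 0" by (simp add: xz)
  qed (use fin in \<open>auto simp: X_def Y_def\<close>)
  also have "\<dots> \<le> (\<Sum>(x, z)\<in>X \<union> Y. ln (real N))"
    using mangoldt_int_le_ln[OF N] by (intro sum_mono) auto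
  also have "\<dots> = ln (real N) * real (card (X \<union> Y))" by simp
  also have "real (card (X \<union> Y)) \<le> real (card X) + real (card Y)"
    using card_Un_le[of X Y] by (simp flip: of_nat_add)
  also have "real (card Y) \<le> real (card F) * real (card E)"
  proof -
    have "Y \<subseteq> (\<lambda>(z, n). (z + int n, z)) ` (F \<times> E)"
      by (auto simp: Y_def image_iff algebra_simps)
    then have "card Y \<le> card (F \<times> E)" using fin finE by (intro surj_card_le) auto
    then show ?thesis by (simp add: card_cartesian_product flip: of_nat_mult)
  qed
  also have "real (card E) \<le> real R * (2 * ln (real N))"
    unfolding E_def using N by (rule card_primepow_small_base_le)
  finally show ?thesis using L by (simp add: X_def mult_left_mono)
qed

text \<open>
  For small \<open>y\<close> the trivial bound suffices. For the others choose \<open>Q \<ge> 20 / y\<close>, so that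
  \<open>N / \<surd>Q \<le> \<surd>(a b)\<close> and the two terms of \<open>bilinear_selberg_sieve\<close> balance, while \<open>log Q\<close> is still at
  most a constant times \<open>Log y\<close>. Here \<open>a\<close> and \<open>b\<close> are the cardinalities of \<open>F\<close> and \<open>G\<close>.
\<close>

lemma sum_mangoldt_int_le:
  fixes M :: int and N :: nat
  assumes N: "N \<ge> 1" and F: "F \<subseteq> {M..<M + int N}" "F \<noteq> {}" and G: "G \<subseteq> {M..<M + int N}" "G \<noteq> {}"
  defines "y \<equiv> real (card F) * real (card G) / (real N)\<^sup>2"
  shows "(\<Sum>x\<in>G. \<Sum>z\<in>F. mangoldt_int N (x - z))
    \<le> 10000 * (real (card F) * real (card G) * Log y)"
proof -
  define ab where "ab = real (card F) * real (card G)"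
  have fin: "finite F" "finite G" using F G finite_subset by blast+
  have a1: "real (card F) \<ge> 1" "real (card G) \<ge> 1"
    using fin F G by (simp_all add: Suc_le_eq card_gt_0_iff)
  have aN: "card F \<le> N" "card G \<le> N"
    using card_mono[OF _ F(1)] card_mono[OF _ G(1)] by simp_all
  have ab1: "ab \<ge> 1" unfolding ab_def using mult_mono[OF a1] by simp
  have abN: "ab \<le> (real N)\<^sup>2" unfolding ab_def power2_eq_square using aN by (intro mult_mono) auto
  have y: "y > 0" "y \<le> 1" using ab1 abN N by (auto simp: y_def ab_def[symmetric])
  have ab_eq: "ab = y * (real N)\<^sup>2" using N by (simp add: y_def ab_def)
  have Log: "Log y = 1 - ln y" "Log y \<ge> 1" using y by (auto simp: Log_def)
  have L: "ln (real N) \<ge> 0" using N by simp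
  show ?thesis
  proof (cases "y \<le> real N powr (- 1 / 2)")
    case True
    then have "ln y \<le> ln (real N powr (- 1 / 2))" using y by (intro ln_mono) auto
    then have "ln (real N) \<le> 2 * Log y" using N Log by (simp add: ln_powr)
    have "(\<Sum>x\<in>G. \<Sum>z\<in>F. mangoldt_int N (x - z)) \<le> (\<Sum>x\<in>G. \<Sum>z\<in>F. ln (real N))"
      using mangoldt_int_le_ln[OF N] by (intro sum_mono)
    also have "\<dots> = ab * ln (real N)" by (simp add: ab_def)
    also have "\<dots> \<le> ab * (2 * Log y)" using ab1 \<open>ln (real N) \<le> 2 * Log y\<close> by (intro mult_left_mono) auto
    also have "\<dots> \<le> 10000 * (ab * Log y)" using ab1 Log(2) by simp
    finally show ?thesis by (simp add: ab_def)
  next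
    case False
    \<comment> \<open>With the support up to \<open>R \<le> N powr (1 / 8)\<close>, the error term \<open>R ^ 8\<close> of the large sieve
      is at most \<open>N\<close>.\<close>
    define r where "r = real N powr (1 / 8)"
    have r1: "r \<ge> 1" using N by (simp add: r_def ge_one_powr_ge_zero)
    have r8: "r ^ 8 = real N" using N by (simp add: r_def flip: powr_realpow add: powr_powr)
    have r4: "r ^ 4 * y \<ge> 1"
    proof -
      have "r ^ 4 = real N powr (1 / 2)" using N by (simp add: r_def flip: powr_realpow add: powr_powr)
      moreover have "real N powr (1 / 2) * real N powr (- 1 / 2) = 1"
        using N by (simp flip: powr_add)
      moreover have "real N powr (1 / 2) * real N powr (- 1 / 2) \<le> real N powr (1 / 2) * y"
        using False by (intro mult_left_mono) auto
      ultimately show ?thesis by simp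
    qed
    define R where "R = nat \<lfloor>r\<rfloor>"
    define Q where "Q = nat \<lceil>20 / y\<rceil>"
    define P where "P = {p. prime p \<and> Q < p \<and> p \<le> R}"
    define m where "m = sieve_mass P R"
    define X where "X = {(x, z) \<in> G \<times> F. \<forall>p\<in>P. \<not> int p dvd x - z}"
    have R: "real R \<le> r" "r \<le> real R + 1" "R \<ge> 1"
      using r1 by (auto simp: R_def le_nat_floor)
    have lnN: "ln (real N) = 8 * ln r" using r1 by (simp add: r8[symmetric] ln_realpow)
    have Qy: "20 / y \<le> real Q" unfolding Q_def by linarith
    have "1 \<le> 1 / y" using y by simp
    then have "20 \<le> 20 / y" by simp
    have Q20: "Q \<ge> 20" using \<open>20 \<le> 20 / y\<close> Qy by linarith
    have "real Q \<le> 20 / y + 1" using \<open>20 \<le> 20 / y\<close> unfolding Q_def by linarith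
    also have "\<dots> \<le> 21 / y" using \<open>1 \<le> 1 / y\<close> by (simp add: field_simps)
    finally have "ln (real Q) \<le> ln (21 / y)" using Q20 by (intro ln_mono) auto
    also have "\<dots> = ln 21 - ln y" using y by (simp add: ln_div)
    also have "\<dots> \<le> 20 + Log y" using ln_le_minus_one[of 21] Log by simp
    finally have lnQ: "4 + 16 * ln (real Q) \<le> 340 * Log y" using Log(2) by simp
    have finP: "finite P" unfolding P_def by (rule finite_subset[of _ "{..R}"]) auto
    have m: "m \<ge> 1" unfolding m_def using finP R by (intro sieve_mass_ge_1) (auto simp: P_def)
    have "m * real (card X) \<le> ab + (real N + real R ^ 8) / sqrt (real Q) * sqrt ab"
      unfolding m_def X_def ab_def using finP Q20 R(3) F(1) G(1)
      by (intro bilinear_selberg_sieve) (auto simp: P_def)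
    also have "\<dots> \<le> ab + 2 * sqrt ab * sqrt ab"
    proof (intro add_left_mono mult_right_mono)
      have "real R ^ 8 \<le> r ^ 8" using R by (intro power_mono) auto
      then have RN: "real N + real R ^ 8 \<le> 2 * real N" by (simp add: r8)
      have "1 / y \<le> real Q" using Qy y by (smt (verit) divide_right_mono)
      then have "1 \<le> real Q * y" using y by (simp add: field_simps)
      then have "(real N)\<^sup>2 * 1 \<le> (real N)\<^sup>2 * (real Q * y)" by (intro mult_left_mono) auto
      then have "sqrt ((real N)\<^sup>2) \<le> sqrt (real Q * ab)"
        by (intro real_sqrt_le_mono) (simp add: ab_eq mult_ac)
      then have "2 * real N \<le> 2 * sqrt ab * sqrt (real Q)" by (simp add: real_sqrt_mult mult_ac)
      with RN have "real N + real R ^ 8 \<le> 2 * sqrt ab * sqrt (real Q)" by (rule order.trans)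
      then show "(real N + real R ^ 8) / sqrt (real Q) \<le> 2 * sqrt ab"
        using Q20 by (subst pos_divide_le_eq) auto
    qed (use ab1 in auto)
    also have "\<dots> = 3 * ab" using ab1 by simp
    finally have mX: "m * real (card X) \<le> 3 * ab" .
    have "ln (real N) \<le> 8 * ln (real R + 1)" unfolding lnN using R r1 by simp
    also have "\<dots> \<le> 8 * ((4 + 16 * ln (real Q)) * m)"
      unfolding m_def P_def using Q20 by (intro mult_left_mono sieve_mass_lower_bound) auto
    also have "\<dots> \<le> 8 * (340 * Log y * m)" using lnQ m by (intro mult_left_mono mult_right_mono) auto
    finally have "ln (real N) * real (card X) \<le> 8 * (340 * Log y * m) * real (card X)"
      by (intro mult_right_mono) auto
    also have "\<dots> = 2720 * Log y * (m * real (card X))" by simp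
    also have "\<dots> \<le> 2720 * Log y * (3 * ab)" using Log(2) by (intro mult_left_mono mX) auto
    finally have sifted: "ln (real N) * real (card X) \<le> 8160 * (ab * Log y)" by (simp add: mult_ac)
    have lnr: "ln r \<le> r" using ln_le_minus_one[of r] r1 by linarith
    have "ln (real N) * (real (card F) * (real R * (2 * ln (real N))))
        \<le> (8 * r) * (real N * (r * (2 * (8 * r))))"
      unfolding lnN using lnr aN R r1 by (intro mult_mono) auto
    also have "\<dots> = 128 * real N * r ^ 3" by (simp add: power3_eq_cube)
    also have "\<dots> \<le> 128 * real N * r ^ 4" using r1 by (intro mult_left_mono power_increasing) auto
    also have "\<dots> = 128 * real N * r ^ 4 * 1" by simp
    also have "\<dots> \<le> 128 * real N * r ^ 4 * (r ^ 4 * y)"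
      using r4 r1 by (intro mult_left_mono) auto
    also have "\<dots> = 128 * real N * (r ^ 4 * r ^ 4) * y" by (simp only: mult_ac)
    also have "r ^ 4 * r ^ 4 = real N" by (simp add: r8 flip: power_add)
    also have "128 * real N * real N * y = 128 * ab"
      unfolding ab_eq power2_eq_square by (simp only: mult_ac)
    also have "\<dots> \<le> 128 * (ab * Log y)" using ab1 Log(2) by simp
    finally have exceptional: "ln (real N) * (real (card F) * (real R * (2 * ln (real N)))) \<le> 128 * (ab * Log y)" .
    have "(\<Sum>x\<in>G. \<Sum>z\<in>F. mangoldt_int N (x - z))
        \<le> ln (real N) * (real (card X) + real (card F) * (real R * (2 * ln (real N))))"
      unfolding X_def using fin N by (intro sum_mangoldt_int_le_card_sifted) (auto simp: P_def)
    also have "\<dots> \<le> 8160 * (ab * Log y) + 128 * (ab * Log y)"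
      using sifted exceptional unfolding distrib_left by (intro add_mono)
    also have "\<dots> \<le> 10000 * (ab * Log y)" using ab1 Log(2) by simp
    finally show ?thesis by (simp add: ab_def)
  qed
qed

lemma pairing_prime_avg_indicators:
  assumes "finite F" "finite G"
  shows "pairing (prime_avg N (indicator F)) (indicator G)
    = of_real ((\<Sum>x\<in>G. \<Sum>z\<in>F. mangoldt_int N (x - z)) / real N)"
proof -
  have avg: "prime_avg N (indicator F) x = of_real ((\<Sum>z\<in>F. mangoldt_int N (x - z)) / real N)" for x
  proof -
    have "(\<Sum>n=1..N. indicator F (x - int n) * (mangoldt n :: complex))
        = (\<Sum>n\<in>{n\<in>{1..N}. x - int n \<in> F}. mangoldt n)"
      by (intro sum.mono_neutral_cong_right) auto
    also have "\<dots> = (\<Sum>z\<in>{z\<in>F. 1 \<le> x - z \<and> x - z \<le> int N}. mangoldt (nat (x - z)))"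
      by (rule sum.reindex_bij_witness[of _ "\<lambda>z. nat (x - z)" "\<lambda>n. x - int n"]) auto
    also have "\<dots> = (\<Sum>z\<in>F. of_real (mangoldt_int N (x - z)))"
      using assms(1) by (intro sum.mono_neutral_cong_left) (auto simp: mangoldt_int_def)
    finally show ?thesis by (simp add: prime_avg_def)
  qed
  have "pairing (prime_avg N (indicator F)) (indicator G)
      = (\<Sum>\<^sub>\<infinity>x\<in>G. prime_avg N (indicator F) x)"
    unfolding pairing_def by (intro infsum_cong_neutral) (auto simp: indicator_def)
  also have "\<dots> = (\<Sum>x\<in>G. prime_avg N (indicator F) x)" using assms(2) by simp
  also have "\<dots> = of_real ((\<Sum>x\<in>G. \<Sum>z\<in>F. mangoldt_int N (x - z)) / real N)"
    by (simp add: avg sum_divide_distrib)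
  finally show ?thesis .
qed

lemma avg_on_indicator:
  assumes "finite I" "F \<subseteq> I"
  shows "avg_on I (indicator F) = real (card F) / real (card I)"
proof -
  have "(\<Sum>x\<in>I. cmod (indicator F x)) = (\<Sum>x\<in>I. if x \<in> F then 1 else 0)"
    by (intro sum.cong) (auto simp: indicator_def)
  also have "\<dots> = real (card F)" using assms by (simp add: sum.If_cases Int_absorb1)
  finally show ?thesis by (simp add: avg_on_def)
qed

lemma prime_avg_pairing_le:
  fixes N :: nat and I F G :: "int set"
  assumes N: "N \<ge> 1" and I: "int_interval I" "card I = N" and F: "F \<subseteq> I" and G: "G \<subseteq> I"
  defines "y \<equiv> avg_on I (indicator F) * avg_on I (indicator G)"
  assumes t: "t \<ge> 1"
  shows "1 / of_nat N * pairing (prime_avg N (indicator F)) (indicator G)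
    \<le> complex_of_real (10000 * y * Log y ^ t)"
proof -
  obtain M b where "I = {M..b}" using I(1) by (auto simp: int_interval_def)
  then have Ieq: "I = {M..<M + int N}" using I(2) N by auto
  have finI: "finite I" by (simp add: Ieq)
  have fin: "finite F" "finite G" using F G finI finite_subset by blast+
  define T where "T = (\<Sum>x\<in>G. \<Sum>z\<in>F. mangoldt_int N (x - z))"
  have y: "y = real (card F) * real (card G) / (real N)\<^sup>2"
    using avg_on_indicator[OF finI] F G I(2) by (simp add: y_def power2_eq_square)
  have y0: "y \<ge> 0" by (simp add: y)
  have "Log y \<ge> 1" by (simp add: Log_def)
  then have Log: "Log y ^ 1 \<le> Log y ^ t" using t by (intro power_increasing)
  have "T \<le> 10000 * (real (card F) * real (card G) * Log y)"
  proof (cases "F = {} \<or> G = {}")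
    case True
    then show ?thesis by (auto simp: T_def)
  next
    case False
    then show ?thesis
      unfolding T_def y using N F G by (intro sum_mangoldt_int_le) (auto simp: Ieq)
  qed
  then have "T / (real N)\<^sup>2 \<le> 10000 * (real (card F) * real (card G) * Log y) / (real N)\<^sup>2"
    by (intro divide_right_mono) auto
  also have "\<dots> = 10000 * y * Log y ^ 1" by (simp add: y)
  also have "\<dots> \<le> 10000 * y * Log y ^ t" using y0 Log by (intro mult_left_mono) auto
  finally have "complex_of_real (T / (real N)\<^sup>2) \<le> complex_of_real (10000 * y * Log y ^ t)"
    by (simp add: less_eq_complex_def)
  moreover have "1 / of_nat N * pairing (prime_avg N (indicator F)) (indicator G)
      = complex_of_real (T / (real N)\<^sup>2)"
    unfolding pairing_prime_avg_indicators[OF fin] T_def by (simp add: power2_eq_square)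
  ultimately show ?thesis by simp
qed

theorem theorem1p2:
  shows "\<exists>C::real. \<forall>(N::nat) (I::int set) (F::int set) (G::int set).
    N > 30 \<and> int_interval I \<and> card I = N \<and> F \<subseteq> I \<and> G \<subseteq> I \<longrightarrow>
    (let f = (indicator F :: int \<Rightarrow> complex);
         g = (indicator G :: int \<Rightarrow> complex);
         y = avg_on I f * avg_on I g;
         bound = (\<lambda>t::nat. 1 / of_nat N * pairing (prime_avg N f) g \<le> complex_of_real (C * y * Log y ^ t))
     in bound 2 \<and> (generalized_riemann_hypothesis \<longrightarrow> bound 1))"
  unfolding Let_def by (intro exI[of _ 10000] allI impI conjI prime_avg_pairing_le) auto

end
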